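(* Let $G$ be a long-edge graph and let $\Delta$ be a distribution of $G$. Then $Q_{*}^{d,(G[k],\Delta[k])}$ is linear in $k$ for $k$ sufficiently large: there exist constants $a,b$ and an integer $K$ such that $Q_{*}^{d,(G[k],\Delta[k])}=ak+b$ for every integer $k\ge K$ and every $d$ for which $G[k]$ is allowable for $d$. Consequently $Q^{d,G[k]}$ is likewise linear in $k$ for $k$ sufficiently large: there exist constants $a',b'$ and an integer $K'$ such that $Q^{d,G[k]}=a'k+b'$ for every integer $k\ge K'$ and every $d$ for which $G[k]$ is allowable for $d$.
   Context: Long-edge graphs. A long-edge graph is a multigraph $G$ on the vertex set $\{0,1,2,\dots\}$ with finitely many edges, no loops (multiple edges are allowed), each edge $e$ carrying a positive integer weight $w(e)$, and having no short edges, where the length of an edge $e$ between vertices $i$ and $j$ is $l(e)=|i-j|$ and a short edge is an edge of length $1$ and weight $1$. Its multiplicity is $\mu(G)=\prod_e w(e)^2$. An edge between $a<b$ lies over the interval $[i,i+1]$ if $a\le i$ and $i+1\le b$. For $i\ge0$, $w_i=w_i(G)$ is the sum of the weights of all edges lying over $[i,i+1]$. Allowability. For a positive integer $d$, $G$ is allowable for $d$ if (1) all vertices to the right of vertex $d+1$ have degree zero; (2) all edges incident to vertex $d+1$, if any, have weight $1$; (3) $w_i\le i$ for each $i\ge 0$. Orderings. If $G$ is allowable for $d$, the extended graph $\mathrm{ext}_d(G)$ is obtained from $G$ by adding, for each $0\le i\le d$, exactly $i-w_i$ short edges between $i$ and $i+1$. The graph $G'_d$ is obtained by subdividing each edge of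 $\mathrm{ext}_d(G)$ with one new vertex. An ordering of $G'_d$ is a linear ordering of its vertices that extends the usual ordering of $\{0,1,2,\dots\}$ and in which the new vertex on an edge between $a<b$ lies between $a$ and $b$. Two orderings are equivalent if they differ by an automorphism of $G'_d$ fixing the vertices $0,1,2,\dots$ (and respecting edge weights). Numbers $N$. If $G$ is allowable for $d$, $N^{d,G}=\mu(G)\cdot(\text{number of equivalence classes of orderings of }G'_d)$; otherwise $N^{d,G}=0$. A distribution of $G$ is a function $\Delta$ assigning to each edge $e$ of $G$ one of the $l(e)$ intervals $[i,i+1]$ over which $e$ lies; an ordering of $G'_d$ is consistent with $\Delta$ if for each edge $e$ of $G$ the new vertex on $e$ lies within the interval $\Delta(e)$. With the edges of $G$ regarded as labeled (distinguishable) and the added short edges regarded as unlabeled (indistinguishable when they lie over the same interval), $N_*^{d,(G,\Delta)}$ is the number of orderings of $G'_d$ consistent with $\Delta$ if $G$ is allowable for $d$, and $N_*^{d,(G,\Delta)}=0$ otherwise. Numbers $Q$. Let $\alpha(G)$ be the number of permutations of the edges of $G$ preserving endpoints and weights. A subset $E$ of the edge set $\mathrm{Edge}(G)$ is also regarded as the long-edge graph with edge set $E$ (same weights), with the distribution obtained by restricting $\Delta$. For $G$ with at least one edge, $$Q_{*}^{d,(G,\Delta)}=\sum_{\mathcal{P}}(-1)^{p-1}(p-1)!\prod_{E\in\mathcal{P}}N_{*}^{d,(E,\Delta)},\qquad Q^{d,G}=\frac{1}{\alpha(G)}\sum_{\mathcal{P}}(-1)^{p-1}(p-1)!\prod_{E\in\mathcal{P}}\left(\alpha(E)N^{d,E}\right),$$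 where the sums are over all unordered set partitions $\mathcal{P}$ of $\mathrm{Edge}(G)$, the products are over the blocks $E$ of $\mathcal{P}$, and $p$ is the number of blocks. For the graph without edges these quantities are $0$. Offsets. For an integer $k\ge0$, $G[k]$ is the long-edge graph obtained by translating $G$ rightward by $k$ units, and $\Delta[k]$ is the corresponding distribution: if $\Delta(e)=[i,i+1]$ then the translated edge $e[k]$ has $\Delta[k](e[k])=[k+i,k+i+1]$. *)

theory Defs
  imports Complex_Main "HOL-Library.Disjoint_Sets" "HOL-Combinatorics.Permutations"
begin

(* Weighted multigraphs on the vertex set {0,1,2,...}. The edges are elements of a type 'e, so
   that several edges may have the same endpoints and weight. As there are no loops, an edge is
   given by its smaller endpoint lft and its larger endpoint rgt. The three functions matter only
   on the edge set. *)
record 'e multigraph =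
  edges :: "'e set"
  lft :: "'e \<Rightarrow> nat"
  rgt :: "'e \<Rightarrow> nat"
  wgt :: "'e \<Rightarrow> nat"

definition len :: "'e multigraph \<Rightarrow> 'e \<Rightarrow> nat" where
  "len G e = rgt G e - lft G e"

definition short_edge :: "'e multigraph \<Rightarrow> 'e \<Rightarrow> bool" where
  "short_edge G e \<longleftrightarrow> len G e = 1 \<and> wgt G e = 1"

definition long_edge_graph :: "'e multigraph \<Rightarrow> bool" where
  "long_edge_graph G \<longleftrightarrow> finite (edges G) \<and>
     (\<forall>e\<in>edges G. lft G e < rgt G e \<and> 0 < wgt G e \<and> \<not> short_edge G e)"

definition multiplicity :: "'e multigraph \<Rightarrow> nat" where
  "multiplicity G = (\<Prod>e\<in>edges G. (wgt G e)\<^sup>2)"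

(* The interval [i,i+1] is represented by i throughout. *)
definition lies_over :: "'e multigraph \<Rightarrow> 'e \<Rightarrow> nat \<Rightarrow> bool" where
  "lies_over G e i \<longleftrightarrow> lft G e \<le> i \<and> i + 1 \<le> rgt G e"

definition wsum :: "'e multigraph \<Rightarrow> nat \<Rightarrow> nat" where
  "wsum G i = (\<Sum>e\<in>{e\<in>edges G. lies_over G e i}. wgt G e)"

definition incident :: "'e multigraph \<Rightarrow> 'e \<Rightarrow> nat \<Rightarrow> bool" where
  "incident G e v \<longleftrightarrow> v = lft G e \<or> v = rgt G e"

definition degree :: "'e multigraph \<Rightarrow> nat \<Rightarrow> nat" where
  "degree G v = card {e\<in>edges G. incident G e v}"

definition allowable :: "nat \<Rightarrow> 'e multigraph \<Rightarrow> bool" where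
  "allowable d G \<longleftrightarrow>
     (\<forall>v. v > d + 1 \<longrightarrow> degree G v = 0) \<and>
     (\<forall>e\<in>edges G. incident G e (d + 1) \<longrightarrow> wgt G e = 1) \<and>
     (\<forall>i. wsum G i \<le> i)"

(* Short i 0, Short i 1, ... are the short edges added between i and i + 1. The subtraction
   i - wsum G i is not truncated when G is allowable, the only case in which ext is used. *)
datatype 'e ext_edge = Long 'e | Short nat nat

definition ext :: "nat \<Rightarrow> 'e multigraph \<Rightarrow> 'e ext_edge multigraph" where
  "ext d G = \<lparr>
     edges = Long ` edges G \<union> {Short i j | i j. i \<le> d \<and> j < i - wsum G i},
     lft = (\<lambda>x. case x of Long e \<Rightarrow> lft G e | Short i j \<Rightarrow> i),
     rgt = (\<lambda>x. case x of Long e \<Rightarrow> rgt G e | Short i j \<Rightarrow> i + 1),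
     wgt = (\<lambda>x. case x of Long e \<Rightarrow> wgt G e | Short i j \<Rightarrow> 1)\<rparr>"

(* The graph obtained from H by subdividing each edge e with a new vertex Mid e. It is simple; an
   edge is recorded as the pair of its set of endpoints and its weight, and both halves of e
   inherit the weight of e. *)
datatype 'e sub_vertex = Vtx nat | Mid 'e

definition sub_verts :: "'e multigraph \<Rightarrow> 'e sub_vertex set" where
  "sub_verts H = range Vtx \<union> Mid ` edges H"

definition sub_edges :: "'e multigraph \<Rightarrow> ('e sub_vertex set \<times> nat) set" where
  "sub_edges H = (\<Union>e\<in>edges H. {({Vtx (lft H e), Mid e}, wgt H e), ({Mid e, Vtx (rgt H e)}, wgt H e)})"

definition sub_automorphism :: "'e multigraph \<Rightarrow> ('e sub_vertex \<Rightarrow> 'e sub_vertex) \<Rightarrow> bool" where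
  "sub_automorphism H f \<longleftrightarrow> bij_betw f (sub_verts H) (sub_verts H) \<and>
     (\<lambda>(S, w). (f ` S, w)) ` sub_edges H = sub_edges H"

(* Orderings are reflexive linear orders r on the vertices: (u, v) \<in> r means that u = v or u comes
   before v. *)
definition orderings :: "'e multigraph \<Rightarrow> 'e sub_vertex rel set" where
  "orderings H = {r. linear_order_on (sub_verts H) r \<and>
     (\<forall>i j. i \<le> j \<longrightarrow> (Vtx i, Vtx j) \<in> r) \<and>
     (\<forall>e\<in>edges H. (Vtx (lft H e), Mid e) \<in> r \<and> (Mid e, Vtx (rgt H e)) \<in> r)}"

(* Orderings related by an automorphism that fixes every vertex in F. *)
definition ordering_equiv :: "'e multigraph \<Rightarrow> 'e sub_vertex set \<Rightarrow> 'e sub_vertex rel rel" where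
  "ordering_equiv H F = {(r, r'). r \<in> orderings H \<and> r' \<in> orderings H \<and>
     (\<exists>f. sub_automorphism H f \<and> (\<forall>v\<in>F. f v = v) \<and> r' = map_prod f f ` r)}"

definition N :: "nat \<Rightarrow> 'e multigraph \<Rightarrow> nat" where
  "N d G = (if allowable d G
     then multiplicity G * card (orderings (ext d G) // ordering_equiv (ext d G) (range Vtx))
     else 0)"

definition distribution :: "'e multigraph \<Rightarrow> ('e \<Rightarrow> nat) \<Rightarrow> bool" where
  "distribution G \<Delta> \<longleftrightarrow> (\<forall>e\<in>edges G. lies_over G e (\<Delta> e))"

definition consistent_orderings ::
    "nat \<Rightarrow> 'e multigraph \<Rightarrow> ('e \<Rightarrow> nat) \<Rightarrow> 'e ext_edge sub_vertex rel set" where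
  "consistent_orderings d G \<Delta> = {r \<in> orderings (ext d G). \<forall>e\<in>edges G.
     (Vtx (\<Delta> e), Mid (Long e)) \<in> r \<and> (Mid (Long e), Vtx (\<Delta> e + 1)) \<in> r}"

(* An automorphism fixing 0,1,2,... and the new vertices on the edges of G permutes the new
   vertices on the added short edges over each interval. Counting orderings up to these
   automorphisms treats the edges of G as labeled and the short edges as unlabeled. *)
definition N_star :: "nat \<Rightarrow> 'e multigraph \<Rightarrow> ('e \<Rightarrow> nat) \<Rightarrow> nat" where
  "N_star d G \<Delta> = (if allowable d G
     then card (consistent_orderings d G \<Delta> //
            ordering_equiv (ext d G) (range Vtx \<union> Mid ` Long ` edges G))
     else 0)"

definition edge_symmetries :: "'e multigraph \<Rightarrow> nat" where
  "edge_symmetries G = card {\<pi>. \<pi> permutes edges G \<and>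
     (\<forall>e\<in>edges G. lft G (\<pi> e) = lft G e \<and> rgt G (\<pi> e) = rgt G e \<and> wgt G (\<pi> e) = wgt G e)}"

definition subgraph :: "'e multigraph \<Rightarrow> 'e set \<Rightarrow> 'e multigraph" where
  "subgraph G E = G\<lparr>edges := E\<rparr>"

(* A distribution restricts to a subgraph without change, since only its values on the edges of the
   subgraph are used. *)
definition Q_star :: "nat \<Rightarrow> 'e multigraph \<Rightarrow> ('e \<Rightarrow> nat) \<Rightarrow> real" where
  "Q_star d G \<Delta> = (if edges G = {} then 0 else
     (\<Sum>P | partition_on (edges G) P. (- 1) ^ (card P - 1) * fact (card P - 1) *
        (\<Prod>E\<in>P. real (N_star d (subgraph G E) \<Delta>))))"

definition Q :: "nat \<Rightarrow> 'e multigraph \<Rightarrow> real" where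
  "Q d G = (if edges G = {} then 0 else
     1 / real (edge_symmetries G) *
     (\<Sum>P | partition_on (edges G) P. (- 1) ^ (card P - 1) * fact (card P - 1) *
        (\<Prod>E\<in>P. real (edge_symmetries (subgraph G E)) * real (N d (subgraph G E)))))"

definition translate :: "'e multigraph \<Rightarrow> nat \<Rightarrow> 'e multigraph" where
  "translate G k = G\<lparr>lft := (\<lambda>e. lft G e + k), rgt := (\<lambda>e. rgt G e + k)\<rparr>"

definition translate_dist :: "('e \<Rightarrow> nat) \<Rightarrow> nat \<Rightarrow> ('e \<Rightarrow> nat)" where
  "translate_dist \<Delta> k = (\<lambda>e. \<Delta> e + k)"

end

theory Submission
  imports Defs
begin

text \<open>
  An ordering consistent with \<Delta> amounts to an independent arrangement of the new vertices
  inside each interval. If $s_i = i - w_i$ short edges and $n_i$ edges of $G$ have their new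
  vertices in $[i,i+1]$, there are $(s_i+n_i)!/s_i!$ arrangements, so $N_*^{d,(G,\Delta)} =
  \prod_i (i - w_i + 1)(i - w_i + 2) \cdots (i - w_i + n_i)$ (N_star_eq_prod_pochhammer). This
  does not depend on $d$. Translating by $k$ and passing to subsets $E$ of the edges gives set
  functions $F_x(E)$, with the family $x$ of offsets $x_i = i + k$ and with $w_i$, $n_i$ additive
  in $E$, and $Q_*$ is the value at the full edge set of the cumulant, that is of the logarithm of
  $F_x$ for the convolution $(f * g)(A) = \sum_{B \subseteq A} f(B) g(A - B)$ of set functions.

  The point is that $F_x * F_y$ depends only on $x + y$, a multivariate form of the Rothe-Hagen
  identities (subset_conv_slot_product_exchange). Raising one $x_i$ by $1$ changes $F_x(A)$ by the
  sum of $F_{x'}(A - e)$ over the edges $e$ placed at $i$, where $x'$ is the raised family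
  diminished by the weights of $e$ (slot_product_step), and the exchange law follows by induction
  on $A$. With $F_k$ for the offsets $i + k$, in particular $F_{k+1} * F_0 = F_k * F_1$. The
  logarithm turns convolutions into sums (cumulant_subset_conv), so the increments of the cumulant
  of $F_k$ in $k$ are constant: $Q_*$ is affine in $k$ for every $k$ such that $G[k]$ is allowable
  for $d$, and $K = 0$ will do.

  For $Q$, the automorphisms act freely on orderings, because an order automorphism of a finite
  chain is trivial. Counting orbits in two ways gives $\alpha(G) N^{d,G} = \mu(G) \sum_\Delta
  N_*^{d,(G,\Delta)}$ (symmetries_times_N). Expanding the products over the blocks of a partition
  yields $\alpha(G) Q^{d,G} = \mu(G) \sum_\Delta Q_*^{d,(G,\Delta)}$ (Q_eq_sum_Q_star), a finite
  combination of affine functions whose coefficients are invariant under translation.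
\<close>


section \<open>Cumulants of set functions\<close>

text \<open>
  The multiplication of the ring of formal sums $\sum_A f(A) \prod_{e \in A} t_e$ with $t_e^2 =
  0$.
\<close>
definition subset_conv :: "('a set \<Rightarrow> real) \<Rightarrow> ('a set \<Rightarrow> real) \<Rightarrow> 'a set \<Rightarrow> real" where
  "subset_conv f g A = (\<Sum>B\<in>Pow A. f B * g (A - B))"

text \<open>
  The logarithm with respect to this multiplication, for set functions that are 1 at the empty
  set. Only its values at nonempty sets are those of the logarithm: at the empty set it is 1
  instead of 0.
\<close>
definition cumulant :: "('a set \<Rightarrow> real) \<Rightarrow> 'a set \<Rightarrow> real" where
  "cumulant f A = (\<Sum>P | partition_on A P. (- 1) ^ (card P - 1) * fact (card P - 1) * (\<Prod>E\<in>P. f E))"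

lemma subset_conv_cong:
  assumes "\<And>B. B \<subseteq> A \<Longrightarrow> f B = f' B" and "\<And>B. B \<subseteq> A \<Longrightarrow> g B = g' B"
  shows "subset_conv f g A = subset_conv f' g' A"
  unfolding subset_conv_def by (rule sum.cong) (auto simp: assms)

lemma subset_conv_add_left: "subset_conv (\<lambda>B. f B + g B) h A = subset_conv f h A + subset_conv g h A"
  by (simp add: subset_conv_def distrib_right sum.distrib)

lemma subset_conv_commute: "subset_conv f g A = subset_conv g f A"
  unfolding subset_conv_def
  by (rule sum.reindex_bij_witness[of _ "\<lambda>B. A - B" "\<lambda>B. A - B"]) (auto simp: double_diff)

lemma subset_conv_assoc:
  assumes "finite A"
  shows "subset_conv (subset_conv f g) h A = subset_conv f (subset_conv g h) A"
proof -
  have fin: "\<And>B. B \<subseteq> A \<Longrightarrow> finite B"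
    using assms by (rule finite_subset[rotated])
  have "subset_conv (subset_conv f g) h A
      = (\<Sum>(C, B)\<in>Sigma (Pow A) Pow. f B * g (C - B) * h (A - C))"
    unfolding subset_conv_def sum_distrib_right
    by (subst sum.Sigma) (use fin assms in auto)
  also have "\<dots> = (\<Sum>(B, D)\<in>Sigma (Pow A) (\<lambda>B. Pow (A - B)). f B * (g D * h (A - B - D)))"
    by (rule sum.reindex_bij_witness[of _ "\<lambda>(B, D). (B \<union> D, B)" "\<lambda>(C, B). (B, C - B)"])
      (auto simp: Un_absorb1 Diff_eq intro!: arg_cong[where f = h])
  also have "\<dots> = subset_conv f (subset_conv g h) A"
    unfolding subset_conv_def sum_distrib_left
    by (subst sum.Sigma) (use fin assms in auto)
  finally show ?thesis .
qed

lemma cumulant_cong: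
  assumes "\<And>B. B \<subseteq> A \<Longrightarrow> f B = g B"
  shows "cumulant f A = cumulant g A"
  unfolding cumulant_def
  by (intro sum.cong refl arg_cong2[where f = "(*)"] prod.cong)
    (auto simp: partition_on_def intro!: assms)

text \<open>
  A partition of a proper subset \<open>B\<close> containing \<open>e\<close> becomes a partition
  of \<open>A\<close> with a marked block not containing \<open>e\<close> when the complement of
  \<open>B\<close> is added as the marked block.
\<close>
lemma cumulant_proper_part:
  assumes fin: "finite A" and e: "e \<in> A"
  shows "(\<Sum>B | B \<subset> A \<and> e \<in> B. cumulant f B * f (A - B)) =
    (\<Sum>P | partition_on A P. \<Sum>X | X \<in> P \<and> e \<notin> X.
       (- 1) ^ (card P - 2) * fact (card P - 2) * (\<Prod>E\<in>P. f E))"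
proof -
  have finB: "\<And>B. B \<subseteq> A \<Longrightarrow> finite B"
    using fin by (rule finite_subset[rotated])
  have finP: "\<And>B P. B \<subseteq> A \<Longrightarrow> partition_on B P \<Longrightarrow> finite P"
    using finB finite_elements by blast
  have finPs: "\<And>B. B \<subseteq> A \<Longrightarrow> finite {P. partition_on B P}"
    using finB finitely_many_partition_on by blast
  let ?S = "Sigma {B. B \<subset> A \<and> e \<in> B} (\<lambda>B. {P. partition_on B P})"
  let ?T = "Sigma {P. partition_on A P} (\<lambda>P. {X. X \<in> P \<and> e \<notin> X})"
  have finbs: "finite {B. B \<subset> A \<and> e \<in> B}"
    by (rule finite_subset[of _ "Pow A"]) (use fin in auto)
  have "(\<Sum>B | B \<subset> A \<and> e \<in> B. cumulant f B * f (A - B))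
      = (\<Sum>(B, P)\<in>?S. (- 1) ^ (card P - 1) * fact (card P - 1) * (\<Prod>E\<in>P. f E) * f (A - B))"
    unfolding cumulant_def sum_distrib_right
    by (subst sum.Sigma) (use finbs finPs in auto)
  also have "\<dots> = (\<Sum>(P, X)\<in>?T. (- 1) ^ (card P - 2) * fact (card P - 2) * (\<Prod>E\<in>P. f E))"
  proof (rule sum.reindex_bij_witness[of _ "\<lambda>(P, X). (A - X, P - {X})"
        "\<lambda>(B, P). (insert (A - B) P, A - B)"])
    fix z assume "z \<in> ?S"
    then obtain B P where z: "z = (B, P)" and B: "B \<subset> A" "e \<in> B" and P: "partition_on B P"
      by auto
    have UP: "\<Union>P = B"
      using P by (auto simp: partition_on_def)
    have notin: "A - B \<notin> P"
      using UP B by blast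
    have part: "partition_on A (insert (A - B) P)"
      using P B by (auto simp: partition_on_def disjoint_def)
    show "(case (case z of (B, P) \<Rightarrow> (insert (A - B) P, A - B)) of (P, X) \<Rightarrow> (A - X, P - {X})) = z"
      using notin B z by (auto simp: double_diff)
    show "(case z of (B, P) \<Rightarrow> (insert (A - B) P, A - B)) \<in> ?T"
      using part z B by auto
    have "finite P"
      using finP B P by auto
    moreover have "P \<noteq> {}"
      using UP B by auto
    then have "card P > 0"
      using \<open>finite P\<close> by (simp add: card_gt_0_iff)
    ultimately show "(case (case z of (B, P) \<Rightarrow> (insert (A - B) P, A - B)) of (P, X) \<Rightarrow>
          (- 1) ^ (card P - 2) * fact (card P - 2) * (\<Prod>E\<in>P. f E)) =
        (case z of (B, P) \<Rightarrow>
          (- 1) ^ (card P - 1) * fact (card P - 1) * (\<Prod>E\<in>P. f E) * f (A - B))"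
      using notin z by (simp add: numeral_2_eq_2)
  next
    fix z assume "z \<in> ?T"
    then obtain P X where z: "z = (P, X)" and P: "partition_on A P" and X: "X \<in> P" "e \<notin> X"
      by auto
    have sub: "X \<subseteq> A" "X \<noteq> {}"
      using P X by (auto simp: partition_on_def)
    have part: "partition_on (A - X) (P - {X})"
    proof -
      have "disjoint P" "\<Union>P = A" "{} \<notin> P"
        using P by (auto simp: partition_on_def)
      then show ?thesis
        using X by (auto simp: partition_on_def disjoint_def)
    qed
    show "(case (case z of (P, X) \<Rightarrow> (A - X, P - {X})) of (B, P) \<Rightarrow> (insert (A - B) P, A - B)) = z"
      using z X sub by (auto simp: double_diff)
    show "(case z of (P, X) \<Rightarrow> (A - X, P - {X})) \<in> ?S"
      using z part X sub e by auto
  qed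
  also have "\<dots> = (\<Sum>P | partition_on A P. \<Sum>X | X \<in> P \<and> e \<notin> X.
       (- 1) ^ (card P - 2) * fact (card P - 2) * (\<Prod>E\<in>P. f E))"
    using finPs finP[OF order_refl] by (subst sum.Sigma) auto
  finally show ?thesis .
qed

text \<open>
  A partition of \<open>A\<close> with $p$ blocks has $p - 1$ blocks that avoid \<open>e\<close>,
  so it occurs once with coefficient $(-1)^{p-1}(p-1)!$ for \<open>B = A\<close> and $p - 1$ times
  with $(-1)^{p-2}(p-2)!$ for the proper subsets. These contributions cancel unless $p = 1$.
\<close>
lemma cumulant_recursion:
  assumes fin: "finite A" and e: "e \<in> A" and f0: "f {} = 1"
  shows "f A = (\<Sum>B | B \<subseteq> A \<and> e \<in> B. cumulant f B * f (A - B))"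
proof -
  let ?c = "\<lambda>P. (- 1) ^ (card P - 1) * fact (card P - 1) * (\<Prod>E\<in>P. f E)"
  have split: "{B. B \<subseteq> A \<and> e \<in> B} = insert A {B. B \<subset> A \<and> e \<in> B}"
    using e by auto
  have "finite {B. B \<subset> A \<and> e \<in> B}"
    by (rule finite_subset[of _ "Pow A"]) (use fin in auto)
  then have "(\<Sum>B | B \<subseteq> A \<and> e \<in> B. cumulant f B * f (A - B))
      = cumulant f A + (\<Sum>B | B \<subset> A \<and> e \<in> B. cumulant f B * f (A - B))"
    unfolding split by (subst sum.insert) (auto simp: f0)
  also have "\<dots> = (\<Sum>P | partition_on A P. ?c P + (\<Sum>X | X \<in> P \<and> e \<notin> X.
       (- 1) ^ (card P - 2) * fact (card P - 2) * (\<Prod>E\<in>P. f E)))"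
    unfolding cumulant_proper_part[OF fin e] sum.distrib by (simp add: cumulant_def)
  also have "\<dots> = (\<Sum>P | partition_on A P. if P = {A} then f A else 0)"
  proof (rule sum.cong[OF refl])
    fix P assume "P \<in> {P. partition_on A P}"
    then have P: "partition_on A P"
      by simp
    have finP: "finite P"
      using finite_elements[OF fin P] .
    have UP: "\<Union>P = A" and dis: "disjoint P"
      using P by (auto simp: partition_on_def)
    obtain Y where Y: "Y \<in> P" "e \<in> Y"
      using e UP by auto
    have others: "{X. X \<in> P \<and> e \<notin> X} = P - {Y}"
      using Y dis by (auto simp: disjoint_def)
    then have card_others: "card {X. X \<in> P \<and> e \<notin> X} = card P - 1"
      using Y by simp
    show "?c P + (\<Sum>X | X \<in> P \<and> e \<notin> X.
        (- 1) ^ (card P - 2) * fact (card P - 2) * (\<Prod>E\<in>P. f E)) = (if P = {A} then f A else 0)"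
    proof (cases "P = {Y}")
      case True
      then have "P = {A}"
        using UP by auto
      then show ?thesis
        unfolding others using True by simp
    next
      case False
      then have "P - {Y} \<noteq> {}"
        using Y by auto
      then have "card (P - {Y}) > 0"
        using finP by (simp add: card_gt_0_iff)
      then obtain m where m: "card P = Suc (Suc m)"
        using Y finP by (metis card_Suc_Diff1 gr0_conv_Suc)
      then have "P \<noteq> {A}"
        by auto
      then show ?thesis
        by (simp add: card_others m algebra_simps)
    qed
  qed
  also have "\<dots> = f A"
    using e finitely_many_partition_on[OF fin] partition_on_space[of A]
    by (subst sum.delta) auto
  finally show ?thesis ..
qed

text \<open>
  Restriction \<open>D\<close> to the sets containing a fixed element \<open>e\<close> is a
  derivation for the convolution, and the recursion says that \<open>D q\<close> is the
  convolution of \<open>D (cumulant q)\<close> with \<open>q\<close>. The Leibniz rule shows that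
  the convolution of \<open>D (cumulant f) + D (cumulant g)\<close> with \<open>subset_conv f g\<close>
  is \<open>D (subset_conv f g)\<close>. This determines the logarithmic derivative of \<open>subset_conv f
  g\<close> by recursion on subsets, since \<open>subset_conv f g\<close> is 1 at the empty set.
\<close>
lemma cumulant_subset_conv:
  assumes "finite A" and "A \<noteq> {}" and f0: "f {} = 1" and g0: "g {} = 1"
  shows "cumulant (subset_conv f g) A = cumulant f A + cumulant g A"
  using assms(1,2)
proof (induction A rule: finite_psubset_induct)
  case (psubset A)
  let ?h = "subset_conv f g"
  obtain e where e: "e \<in> A"
    using psubset.prems by auto
  \<comment> \<open>the partial derivative in $t_e$, multiplied by $t_e$\<close>
  define D where "D = (\<lambda>(q :: 'a set \<Rightarrow> real) B. if e \<in> B then q B else 0)"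
  have h0: "?h {} = 1"
    by (simp add: subset_conv_def f0 g0)
  have finB: "\<And>B. B \<subseteq> A \<Longrightarrow> finite B"
    using psubset.hyps by (rule finite_subset[rotated])
  have D_subset_conv: "D (subset_conv p q) B = subset_conv (D p) q B + subset_conv (D q) p B" for p q B
  proof -
    have "subset_conv (D q) p B = subset_conv p (D q) B"
      by (rule subset_conv_commute)
    then show ?thesis
      by (auto simp: D_def subset_conv_def sum.distrib[symmetric] intro!: sum.cong sum.neutral)
  qed
  have D_eq: "D q B = subset_conv (D (cumulant q)) q B" if "B \<subseteq> A" "q {} = 1" for q B
  proof (cases "e \<in> B")
    case True
    have "subset_conv (D (cumulant q)) q B = (\<Sum>C\<in>{C\<in>Pow B. e \<in> C}. cumulant q C * q (B - C))"
      unfolding subset_conv_def D_def by (subst sum.inter_filter) 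
      (auto simp: finB that if_distrib cong: if_cong intro!: sum.cong)
    then show ?thesis
      using cumulant_recursion[OF finB[OF that(1)] True, of q] that True by (simp add: D_def)
  next
    case False
    have "subset_conv (D (cumulant q)) q B = 0"
      unfolding subset_conv_def by (rule sum.neutral) (use False in \<open>auto simp: D_def\<close>)
    then show ?thesis
      using False by (simp add: D_def)
  qed
  have "?h A = D ?h A"
    by (simp add: D_def e)
  also have "\<dots> = subset_conv (subset_conv (D (cumulant f)) f) g A + subset_conv (subset_conv (D (cumulant g)) g) f A"
    unfolding D_subset_conv by (intro arg_cong2[where f = "(+)"] subset_conv_cong) (auto simp: D_eq f0 g0)
  also have "\<dots> = subset_conv (D (cumulant f)) ?h A + subset_conv (D (cumulant g)) ?h A"
    unfolding subset_conv_assoc[OF psubset.hyps] by (simp add: ext[OF subset_conv_commute[of g f]])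
  also have "\<dots> = subset_conv (\<lambda>B. D (cumulant f) B + D (cumulant g) B) ?h A"
    by (simp add: subset_conv_add_left)
  finally have 1: "?h A = subset_conv (\<lambda>B. D (cumulant f) B + D (cumulant g) B) ?h A" .
  have 2: "?h A = subset_conv (D (cumulant ?h)) ?h A"
    using D_eq[of A ?h] h0 e by (simp add: D_def)
  have split: "subset_conv q ?h A = q A + (\<Sum>B | B \<subset> A. q B * ?h (A - B))" for q
  proof -
    have "Pow A = insert A {B. B \<subset> A}"
      by auto
    moreover have "finite {B. B \<subset> A}"
      by (rule finite_subset[of _ "Pow A"]) (use psubset.hyps in auto)
    ultimately show ?thesis
      unfolding subset_conv_def[of q] by (simp add: h0)
  qed
  have "(\<Sum>B | B \<subset> A. D (cumulant ?h) B * ?h (A - B))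
      = (\<Sum>B | B \<subset> A. (D (cumulant f) B + D (cumulant g) B) * ?h (A - B))"
  proof (rule sum.cong[OF refl])
    fix B assume "B \<in> {B. B \<subset> A}"
    then show "D (cumulant ?h) B * ?h (A - B) =
        (D (cumulant f) B + D (cumulant g) B) * ?h (A - B)"
      using psubset.IH[of B] by (cases "e \<in> B") (auto simp: D_def)
  qed
  then show ?case
    using 1 2 unfolding split by (simp add: D_def e)
qed


section \<open>Products of rising factorials\<close>

text \<open>
  For offsets \<open>x i = i + k\<close> and weights \<open>w e i\<close> of the edges over the
  interval \<open>i\<close>, this counts the orderings of the edges in \<open>A\<close>,
  translated by \<open>k\<close>, that are consistent with \<open>D\<close>. Integer offsets make
  it a polynomial expression that needs no bound on the weights.
\<close>
definition slot_product :: "'i set \<Rightarrow> ('e \<Rightarrow> 'i) \<Rightarrow> ('e \<Rightarrow> 'i \<Rightarrow> int) \<Rightarrow> ('i \<Rightarrow> int) \<Rightarrow> 'e set \<Rightarrow> real" where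
  "slot_product I D w x A =
     (\<Prod>i\<in>I. pochhammer (real_of_int (x i - (\<Sum>e\<in>A. w e i)) + 1) (card {e\<in>A. D e = i}))"

lemma pochhammer_difference:
  fixes a :: "'a::comm_ring_1"
  shows "pochhammer (a + 1) n = pochhammer a n + of_nat n * pochhammer (a + 1) (n - 1)"
proof (cases n)
  case (Suc m)
  then show ?thesis
    unfolding Suc pochhammer_Suc[of "a + 1"] pochhammer_rec[of a] by (simp add: algebra_simps)
qed simp

lemma slot_product_cong:
  assumes "\<And>i. i \<in> I \<Longrightarrow> x i = y i"
  shows "slot_product I D w x = slot_product I D w y"
  by (auto simp: slot_product_def fun_eq_iff assms intro!: prod.cong)

lemma slot_product_empty [simp]: "slot_product I D w x {} = 1"
  by (simp add: slot_product_def)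

text \<open>
  In the factor at \<open>i\<close> the difference of pochhammer symbols gives one copy of a
  shorter symbol for each edge placed at \<open>i\<close>. Removing such an edge \<open>e\<close>
  from \<open>A\<close> lowers the length of this symbol and raises all bases by the weights of
  \<open>e\<close>, which subtracting \<open>w e\<close> from the offsets undoes.
\<close>
lemma slot_product_step:
  fixes x :: "'i \<Rightarrow> int"
  assumes I: "finite I" "i \<in> I" and A: "finite A"
  defines "y \<equiv> \<lambda>j. x j + of_bool (j = i)"
  shows "slot_product I D w y A = slot_product I D w x A +
     (\<Sum>e\<in>{e\<in>A. D e = i}. slot_product I D w (\<lambda>j. y j - w e j) (A - {e}))"
proof -
  define W where "W j = (\<Sum>e\<in>A. w e j)" for j
  define n where "n j = card {e\<in>A. D e = j}" for j
  define R where "R = (\<Prod>j\<in>I - {i}. pochhammer (real_of_int (x j - W j) + 1) (n j))"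
  define a where "a = real_of_int (x i - W i) + 1"
  have split: "(\<Prod>j\<in>I. f j) = f i * (\<Prod>j\<in>I - {i}. f j)" for f :: "'i \<Rightarrow> real"
    using I by (rule prod.remove)
  have x: "slot_product I D w x A = pochhammer a (n i) * R"
    unfolding slot_product_def split by (simp add: a_def R_def W_def n_def)
  have R': "(\<Prod>j\<in>I - {i}. pochhammer (real_of_int (y j - W j) + 1) (n j)) = R"
    unfolding R_def by (rule prod.cong) (auto simp: y_def)
  have y: "slot_product I D w y A = pochhammer (a + 1) (n i) * R"
    unfolding slot_product_def split R'[symmetric] W_def[symmetric] n_def[symmetric]
    by (simp add: a_def y_def algebra_simps)
  have "slot_product I D w (\<lambda>j. y j - w e j) (A - {e}) = pochhammer (a + 1) (n i - 1) * R"
    if e: "e \<in> A" "D e = i" for e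
  proof -
    have W: "(\<Sum>e\<in>A - {e}. w e j) = W j - w e j" for j
      using A e by (simp add: W_def sum_diff1)
    have fib: "{e'\<in>A - {e}. D e' = j} = {e'\<in>A. D e' = j} - (if j = i then {e} else {})" for j
      using e by auto
    have n: "card {e'\<in>A - {e}. D e' = j} = n j - of_bool (j = i)" for j
      unfolding fib n_def using e by simp
    show ?thesis
      unfolding slot_product_def split W n R'[symmetric]
      by (intro arg_cong2[where f = "(*)"] prod.cong) (auto simp: a_def y_def algebra_simps)
  qed
  then have "(\<Sum>e\<in>{e\<in>A. D e = i}. slot_product I D w (\<lambda>j. y j - w e j) (A - {e}))
      = real (n i) * pochhammer (a + 1) (n i - 1) * R"
    by (simp add: n_def)
  then show ?thesis
    using pochhammer_difference[of a "n i"] by (simp add: x y distrib_right)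
qed

lemma subset_conv_slot_product_step:
  fixes x :: "'i \<Rightarrow> int"
  assumes I: "finite I" "i \<in> I" and A: "finite A"
  defines "y \<equiv> \<lambda>j. x j + of_bool (j = i)"
  shows "subset_conv (slot_product I D w y) g A = subset_conv (slot_product I D w x) g A +
     (\<Sum>e\<in>{e\<in>A. D e = i}. subset_conv (slot_product I D w (\<lambda>j. y j - w e j)) g (A - {e}))"
proof -
  let ?F = "slot_product I D w"
  let ?Fe = "\<lambda>e. ?F (\<lambda>j. y j - w e j)"
  have finB: "\<And>B. B \<subseteq> A \<Longrightarrow> finite B"
    using A by (rule finite_subset[rotated])
  have "subset_conv (?F y) g A = subset_conv (?F x) g A +
      (\<Sum>B\<in>Pow A. \<Sum>e\<in>{e\<in>B. D e = i}. ?Fe e (B - {e}) * g (A - B))"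
    unfolding subset_conv_def sum.distrib[symmetric]
    by (rule sum.cong) (simp_all add: y_def slot_product_step[OF I finB] sum_distrib_right
        distrib_right)
  also have "(\<Sum>B\<in>Pow A. \<Sum>e\<in>{e\<in>B. D e = i}. ?Fe e (B - {e}) * g (A - B))
      = (\<Sum>(B, e)\<in>Sigma (Pow A) (\<lambda>B. {e\<in>B. D e = i}). ?Fe e (B - {e}) * g (A - B))"
    by (subst sum.Sigma) (use A finB in auto)
  also have "\<dots> = (\<Sum>(e, B)\<in>Sigma {e\<in>A. D e = i} (\<lambda>e. Pow (A - {e})). ?Fe e B * g (A - {e} - B))"
  proof (rule sum.reindex_bij_witness[of _ "\<lambda>(e, B). (insert e B, e)" "\<lambda>(B, e). (e, B - {e})"])
    fix z assume "z \<in> Sigma (Pow A) (\<lambda>B. {e\<in>B. D e = i})"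
    then obtain B e where z: "z = (B, e)" "B \<subseteq> A" "e \<in> B" "D e = i"
      by auto
    then have "A - {e} - (B - {e}) = A - B"
      by auto
    then show "(case (case z of (B, e) \<Rightarrow> (e, B - {e})) of (e, B) \<Rightarrow> ?Fe e B * g (A - {e} - B)) =
        (case z of (B, e) \<Rightarrow> ?Fe e (B - {e}) * g (A - B))"
      using z by simp
  qed auto
  also have "\<dots> = (\<Sum>e\<in>{e\<in>A. D e = i}. subset_conv (?Fe e) g (A - {e}))"
    unfolding subset_conv_def by (subst sum.Sigma) (use A in auto)
  finally show ?thesis .
qed

text \<open>
  By the step formula, moving a unit from one family of offsets to the other changes the two sides
  by sums over smaller sets \<open>A - {e}\<close>, which agree by induction for arbitrary integer
  displacements. The displacements that may be exchanged on \<open>A\<close> form a group, and the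
  units generate it on \<open>I\<close>.
\<close>
lemma subset_conv_slot_product_exchange:
  assumes I: "finite I" and A: "finite A"
  shows "subset_conv (slot_product I D w (\<lambda>j. x j + z j)) (slot_product I D w y) A =
    subset_conv (slot_product I D w x) (slot_product I D w (\<lambda>j. y j + z j)) A"
  using A
proof (induction A arbitrary: x y z rule: finite_psubset_induct)
  case (psubset A)
  let ?F = "slot_product I D w"
  \<comment> \<open>the group of displacements \<open>z\<close> that may be exchanged on \<open>A\<close>\<close>
  define T where "T z \<longleftrightarrow> (\<forall>x y. subset_conv (?F (\<lambda>j. x j + z j)) (?F y) A =
    subset_conv (?F x) (?F (\<lambda>j. y j + z j)) A)" for z :: "'a \<Rightarrow> int"
  have unit: "T (\<lambda>j. of_bool (j = i))" if i: "i \<in> I" for i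
    unfolding T_def
  proof (intro allI)
    fix x y :: "'a \<Rightarrow> int"
    let ?u = "\<lambda>j. of_bool (j = i) :: int"
    have "subset_conv (?F (\<lambda>j. x j + ?u j - w e j)) (?F y) (A - {e}) =
        subset_conv (?F (\<lambda>j. y j + ?u j - w e j)) (?F x) (A - {e})" if "e \<in> A" for e
    proof -
      have "A - {e} \<subset> A"
        using that by auto
      from psubset.IH[OF this, of x "\<lambda>j. ?u j - w e j" y]
      show ?thesis
        by (simp add: subset_conv_commute[of "?F x"] algebra_simps)
    qed
    then show "subset_conv (?F (\<lambda>j. x j + ?u j)) (?F y) A = subset_conv (?F x) (?F (\<lambda>j. y j + ?u j)) A"
      using subset_conv_slot_product_step[OF I i psubset.hyps, of D w x "?F y"]
        subset_conv_slot_product_step[OF I i psubset.hyps, of D w y "?F x"]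
      by (simp add: subset_conv_commute[of "?F x"])
  qed
  have add: "T (\<lambda>j. u j + v j)" if "T u" "T v" for u v
    unfolding T_def
  proof (intro allI)
    fix x y :: "'a \<Rightarrow> int"
    have "subset_conv (?F (\<lambda>j. x j + v j + u j)) (?F y) A =
        subset_conv (?F (\<lambda>j. x j + v j)) (?F (\<lambda>j. y j + u j)) A"
      using that(1)[unfolded T_def, rule_format, of "\<lambda>j. x j + v j" y] .
    also have "\<dots> = subset_conv (?F x) (?F (\<lambda>j. y j + u j + v j)) A"
      using that(2)[unfolded T_def, rule_format, of x "\<lambda>j. y j + u j"] .
    finally show "subset_conv (?F (\<lambda>j. x j + (u j + v j))) (?F y) A =
        subset_conv (?F x) (?F (\<lambda>j. y j + (u j + v j))) A"
      by (simp add: ac_simps)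
  qed
  have minus: "T (\<lambda>j. - u j)" if "T u" for u
    unfolding T_def
  proof (intro allI)
    fix x y :: "'a \<Rightarrow> int"
    have "subset_conv (?F (\<lambda>j. (x j - u j) + u j)) (?F (\<lambda>j. y j - u j)) A =
        subset_conv (?F (\<lambda>j. x j - u j)) (?F (\<lambda>j. (y j - u j) + u j)) A"
      using that[unfolded T_def, rule_format, of "\<lambda>j. x j - u j" "\<lambda>j. y j - u j"] .
    then show "subset_conv (?F (\<lambda>j. x j + - u j)) (?F y) A = subset_conv (?F x) (?F (\<lambda>j. y j + - u j)) A"
      by simp
  qed
  have zero: "T (\<lambda>j. 0)"
    by (simp add: T_def)
  have multiple: "T (\<lambda>j. c * of_bool (j = i))" if i: "i \<in> I" for c i
  proof (induction c rule: int_induct[of _ 0])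
    case (step1 c)
    from add[OF step1(2) unit[OF i]] show ?case
      by (simp add: algebra_simps)
  next
    case (step2 c)
    from add[OF step2(2) minus[OF unit[OF i]]] show ?case
      by (simp add: algebra_simps)
  qed (simp add: zero)
  have "T (\<lambda>j. \<Sum>i\<in>J. z i * of_bool (j = i))" if "J \<subseteq> I" for J
    using finite_subset[OF that I] that
  proof (induction J rule: finite_induct)
    case (insert i J)
    then show ?case
      using add[OF multiple[of i "z i"]] by (simp del: sum_mult_of_bool_eq)
  qed (simp add: zero)
  from this[OF order_refl] have
    "subset_conv (?F (\<lambda>j. x j + (\<Sum>i\<in>I. z i * of_bool (j = i)))) (?F y) A =
     subset_conv (?F x) (?F (\<lambda>j. y j + (\<Sum>i\<in>I. z i * of_bool (j = i)))) A"
    unfolding T_def by blast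
  moreover have "(\<Sum>i\<in>I. z i * of_bool (j = i)) = z j" if "j \<in> I" for j
    using I that by (simp add: of_bool_def if_distrib cong: if_cong)
  then have "?F (\<lambda>j. x j + (\<Sum>i\<in>I. z i * of_bool (j = i))) = ?F (\<lambda>j. x j + z j)"
      "?F (\<lambda>j. y j + (\<Sum>i\<in>I. z i * of_bool (j = i))) = ?F (\<lambda>j. y j + z j)"
    by (auto intro!: slot_product_cong)
  ultimately show ?case
    by simp
qed

text \<open>
  The exchange law identifies the convolution of the functions for offsets \<open>x + k +
  1\<close> and \<open>x\<close> with that for \<open>x + k\<close> and \<open>x + 1\<close>;
  taking logarithms shows that every step in \<open>k\<close> has the same increment.
\<close>
lemma cumulant_slot_product_shift:
  assumes I: "finite I" and A: "finite A" "A \<noteq> {}"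
  shows "cumulant (slot_product I D w (\<lambda>i. x i + int k)) A =
    (cumulant (slot_product I D w (\<lambda>i. x i + 1)) A - cumulant (slot_product I D w x) A) * real k +
    cumulant (slot_product I D w x) A"
proof (induction k)
  case (Suc k)
  let ?F = "slot_product I D w"
  have fin: "\<And>B. B \<subseteq> A \<Longrightarrow> finite B"
    using A(1) by (rule finite_subset[rotated])
  have "cumulant (?F (\<lambda>i. x i + int (Suc k))) A + cumulant (?F x) A
      = cumulant (subset_conv (?F (\<lambda>i. x i + int k + 1)) (?F x)) A"
    by (subst cumulant_subset_conv) (use A in \<open>auto simp: algebra_simps\<close>)
  also have "\<dots> = cumulant (subset_conv (?F (\<lambda>i. x i + int k)) (?F (\<lambda>i. x i + 1))) A"
    by (intro cumulant_cong subset_conv_slot_product_exchange[OF I]) (rule fin)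
  also have "\<dots> = cumulant (?F (\<lambda>i. x i + int k)) A + cumulant (?F (\<lambda>i. x i + 1)) A"
    by (subst cumulant_subset_conv) (use A in auto)
  finally show ?case
    using Suc.IH by (simp add: algebra_simps)
qed simp


section \<open>Counting permutations and linear orders over a map\<close>

lemma prod_fact_fibers_insert:
  assumes "finite M" "a \<notin> M" "finite V" "c a \<in> V"
  shows "(\<Prod>v\<in>V. fact (card {e\<in>insert a M. c e = v})) =
    card {e\<in>insert a M. c e = c a} * (\<Prod>v\<in>V. fact (card {e\<in>M. c e = v}) :: nat)"
proof -
  have same: "{e\<in>insert a M. c e = c a} = insert a {e\<in>M. c e = c a}"
    by auto
  have other: "{e\<in>insert a M. c e = v} = {e\<in>M. c e = v}" if "v \<noteq> c a" for v
    using that by auto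
  have "(\<Prod>v\<in>V - {c a}. fact (card {e\<in>insert a M. c e = v})) =
      (\<Prod>v\<in>V - {c a}. fact (card {e\<in>M. c e = v}) :: nat)"
    by (intro prod.cong refl arg_cong[where f = "\<lambda>S. fact (card S)"] other) auto
  then show ?thesis
    unfolding prod.remove[OF assms(3,4)] same using assms(1,2) by (simp add: algebra_simps)
qed

text \<open>
  A permutation of \<open>insert a M\<close> is a transposition of \<open>a\<close> with some
  \<open>b\<close> after a permutation of \<open>M\<close>, and it preserves \<open>c\<close>
  exactly if both factors do.
\<close>
lemma card_permutes_preserving:
  assumes "finite M" "finite V" "c ` M \<subseteq> V"
  shows "card {p. p permutes M \<and> (\<forall>e\<in>M. c (p e) = c e)} = (\<Prod>v\<in>V. fact (card {e\<in>M. c e = v}))"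
  using assms(1,3)
proof (induction M rule: finite_induct)
  case empty
  then show ?case by simp
next
  case (insert a M)
  let ?G = "\<lambda>M. {p. p permutes M \<and> (\<forall>e\<in>M. c (p e) = c e)}"
  let ?B = "{b\<in>insert a M. c b = c a}"
  let ?t = "\<lambda>(b, p). transpose a b \<circ> p"
  have preserving: "(\<forall>e\<in>insert a M. c ((transpose a b \<circ> p) e) = c e) \<longleftrightarrow>
      c b = c a \<and> (\<forall>e\<in>M. c (p e) = c e)" if p: "p permutes M" for b p
  proof -
    have "p a = a" and "\<And>e. e \<in> M \<Longrightarrow> p e \<noteq> a"
      using permutes_not_in[OF p insert.hyps(2)] permutes_in_image[OF p] insert.hyps(2) by auto
    then show ?thesis
      by (auto simp: transpose_def)
  qed
  have "?G (insert a M) = ?t ` (?B \<times> ?G M)"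
  proof (intro equalityI subsetI)
    fix q assume q: "q \<in> ?G (insert a M)"
    then have "q \<in> ?t ` {(b, p). b \<in> insert a M \<and> p \<in> {p. p permutes M}}"
      unfolding permutes_insert[symmetric] by simp
    then obtain b p where "q = transpose a b \<circ> p" "b \<in> insert a M" "p permutes M"
      by auto
    then show "q \<in> ?t ` (?B \<times> ?G M)"
      using q preserving[of p b] by auto
  next
    fix q assume "q \<in> ?t ` (?B \<times> ?G M)"
    then obtain b p where q: "q = transpose a b \<circ> p" "b \<in> ?B" "p \<in> ?G M"
      by auto
    then have "q \<in> ?t ` {(b, p). b \<in> insert a M \<and> p \<in> {p. p permutes M}}"
      by auto
    then have "q permutes insert a M"
      unfolding permutes_insert[symmetric] by simp
    then show "q \<in> ?G (insert a M)"
      using q preserving[of p b] by auto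
  qed
  moreover have "inj_on ?t (?B \<times> ?G M)"
  proof (rule inj_onI, clarify)
    fix b p b' p'
    assume p: "p permutes M" "p' permutes M" and eq: "transpose a b \<circ> p = transpose a b' \<circ> p'"
    have "p a = a" "p' a = a"
      using permutes_not_in[OF p(1) insert.hyps(2)] permutes_not_in[OF p(2) insert.hyps(2)] by simp_all
    then have b: "b = b'"
      using fun_cong[OF eq, of a] by simp
    have "transpose a b \<circ> (transpose a b \<circ> p) = transpose a b \<circ> (transpose a b \<circ> p')"
      using eq b by simp
    then have "p = p'"
      by (simp add: comp_assoc[symmetric])
    then show "b = b' \<and> p = p'"
      using b by simp
  qed
  ultimately have "card (?G (insert a M)) = card ?B * card (?G M)"
    by (simp only: card_image card_cartesian_product)
  then show ?case
    using insert prod_fact_fibers_insert[OF insert.hyps assms(2), of c] by simp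
qed

definition monotone_linear_orders :: "'a set \<Rightarrow> ('a \<Rightarrow> nat) \<Rightarrow> 'a rel set" where
  "monotone_linear_orders M \<delta> = {s. linear_order_on M s \<and> (\<forall>(e, e')\<in>s. \<delta> e \<le> \<delta> e')}"

lemma linear_order_on_greatest:
  assumes "finite M" "M \<noteq> {}" "linear_order_on M r"
  shows "\<exists>e\<in>M. \<forall>x\<in>M. (x, e) \<in> r"
proof -
  have r: "trans r" "refl_on M r" "total_on M r"
    using assms(3) by (auto simp: order_on_defs)
  have "\<exists>e\<in>F. \<forall>x\<in>F. (x, e) \<in> r" if "F \<subseteq> M" "F \<noteq> {}" for F
    using finite_subset[OF that(1) assms(1)] that(2,1)
  proof (induction F rule: finite_ne_induct)
    case (singleton x)
    then show ?case
      using r(2) by (auto simp: refl_on_def)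
  next
    case (insert x F)
    then obtain e where e: "e \<in> F" "\<forall>y\<in>F. (y, e) \<in> r"
      by auto
    have "(x, x) \<in> r" "(x, e) \<in> r \<or> (e, x) \<in> r"
      using r insert.prems insert.hyps e(1) by (auto simp: refl_on_def total_on_def)
    then show ?case
      using e r(1) by (auto dest: transD)
  qed
  then show ?thesis
    using assms(2) by blast
qed

lemma finite_monotone_linear_orders:
  assumes "finite M"
  shows "finite (monotone_linear_orders M \<delta>)"
  by (rule finite_subset[of _ "Pow (M \<times> M)"])
    (use assms in \<open>auto simp: monotone_linear_orders_def order_on_defs\<close>)

lemma linear_order_on_adjoin_greatest:
  assumes "e \<in> M" "linear_order_on (M - {e}) s"
  shows "linear_order_on M (s \<union> M \<times> {e})"
  using assms unfolding order_on_defs refl_on_def trans_def antisym_def total_on_def by blast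

lemma linear_order_on_remove:
  assumes "linear_order_on M r"
  shows "linear_order_on (M - {e}) (r \<inter> (M - {e}) \<times> (M - {e}))"
  using assms unfolding order_on_defs refl_on_def trans_def antisym_def total_on_def by blast

lemma monotone_linear_orders_decompose:
  fixes \<delta> :: "'a \<Rightarrow> nat"
  assumes "finite M" "M \<noteq> {}"
  defines "T \<equiv> {e\<in>M. \<delta> e = Max (\<delta> ` M)}"
  shows "monotone_linear_orders M \<delta> =
    (\<Union>e\<in>T. (\<lambda>s. s \<union> M \<times> {e}) ` monotone_linear_orders (M - {e}) \<delta>)"
proof (intro equalityI subsetI)
  fix r assume "r \<in> monotone_linear_orders M \<delta>"
  then have r: "linear_order_on M r" and mono: "\<And>x y. (x, y) \<in> r \<Longrightarrow> \<delta> x \<le> \<delta> y"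
    by (auto simp: monotone_linear_orders_def)
  obtain e where e: "e \<in> M" "\<And>x. x \<in> M \<Longrightarrow> (x, e) \<in> r"
    using linear_order_on_greatest[OF assms(1,2) r] by auto
  have "Max (\<delta> ` M) = \<delta> e"
    by (rule Max_eqI) (use assms e mono in auto)
  then have "e \<in> T"
    using e by (simp add: T_def)
  let ?s = "r \<inter> (M - {e}) \<times> (M - {e})"
  have sub: "r \<subseteq> M \<times> M" and "antisym r"
    using r by (auto simp: order_on_defs)
  then have last: "x = e" if "(e, x) \<in> r" for x
    using that e by (auto dest: antisymD)
  then have "r = ?s \<union> M \<times> {e}"
    using sub e by auto
  moreover have "?s \<in> monotone_linear_orders (M - {e}) \<delta>"
    using linear_order_on_remove[OF r] mono by (auto simp: monotone_linear_orders_def)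
  ultimately show "r \<in> (\<Union>e\<in>T. (\<lambda>s. s \<union> M \<times> {e}) ` monotone_linear_orders (M - {e}) \<delta>)"
    using \<open>e \<in> T\<close> by blast
next
  fix r assume "r \<in> (\<Union>e\<in>T. (\<lambda>s. s \<union> M \<times> {e}) ` monotone_linear_orders (M - {e}) \<delta>)"
  then obtain e s where e: "e \<in> T" and s: "s \<in> monotone_linear_orders (M - {e}) \<delta>"
    and r: "r = s \<union> M \<times> {e}"
    by auto
  have "\<delta> x \<le> \<delta> e" if "x \<in> M" for x
    using e that assms(1) by (simp add: T_def)
  then show "r \<in> monotone_linear_orders M \<delta>"
    using s e linear_order_on_adjoin_greatest[of e M s]
    by (auto simp: monotone_linear_orders_def r T_def)
qed

text \<open>
  Removing the greatest element, which can be any of the elements at which \<open>\<delta>\<close>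
  is maximal, leaves a linear order of the same kind on the remaining set.
\<close>
lemma card_monotone_linear_orders:
  assumes "finite M" "finite V" "\<delta> ` M \<subseteq> V"
  shows "card (monotone_linear_orders M \<delta>) = (\<Prod>v\<in>V. fact (card {e\<in>M. \<delta> e = v}))"
  using assms(1,3)
proof (induction M rule: finite_psubset_induct)
  case (psubset M)
  let ?L = "\<lambda>M. monotone_linear_orders M \<delta>"
  let ?f = "\<lambda>M. \<Prod>v\<in>V. fact (card {e\<in>M. \<delta> e = v}) :: nat"
  show ?case
  proof (cases "M = {}")
    case True
    have "?L {} = {{}}"
      by (auto simp: monotone_linear_orders_def order_on_defs)
    then show ?thesis
      using True by simp
  next
    case False
    define T where "T = {e\<in>M. \<delta> e = Max (\<delta> ` M)}"
    have "Max (\<delta> ` M) \<in> \<delta> ` M"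
      using psubset.hyps False by simp
    then have T: "finite T" "T \<noteq> {}" "T \<subseteq> M"
      using psubset.hyps by (auto simp: T_def)
    have "card (?L M) = (\<Sum>e\<in>T. card ((\<lambda>s. s \<union> M \<times> {e}) ` ?L (M - {e})))"
      unfolding monotone_linear_orders_decompose[OF psubset.hyps False, of \<delta>] T_def[symmetric]
    proof (rule card_UN_disjoint)
      show "\<forall>e\<in>T. finite ((\<lambda>s. s \<union> M \<times> {e}) ` ?L (M - {e}))"
        using psubset.hyps by (simp add: finite_monotone_linear_orders)
      show "\<forall>e\<in>T. \<forall>e'\<in>T. e \<noteq> e' \<longrightarrow>
          (\<lambda>s. s \<union> M \<times> {e}) ` ?L (M - {e}) \<inter> (\<lambda>s. s \<union> M \<times> {e'}) ` ?L (M - {e'}) = {}"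
      proof (intro ballI impI equals0I)
        fix e e' r assume e: "e \<in> T" "e' \<in> T" "e \<noteq> e'"
          and "r \<in> (\<lambda>s. s \<union> M \<times> {e}) ` ?L (M - {e}) \<inter> (\<lambda>s. s \<union> M \<times> {e'}) ` ?L (M - {e'})"
        then obtain s s' where s: "s \<in> ?L (M - {e})" "r = s \<union> M \<times> {e}" "r = s' \<union> M \<times> {e'}"
          by auto
        have "e \<in> M" "e' \<in> M"
          using e T(3) by auto
        then have "(e, e') \<in> r"
          using s(3) by auto
        then have "(e, e') \<in> s"
          using s(2) e(3) by auto
        then show False
          using s(1) by (auto simp: monotone_linear_orders_def order_on_defs)
      qed
    qed (rule T)
    also have "\<dots> = (\<Sum>e\<in>T. ?f (M - {e}))"
    proof (rule sum.cong[OF refl])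
      fix e assume "e \<in> T"
      have "inj_on (\<lambda>s. s \<union> M \<times> {e}) (?L (M - {e}))"
        by (rule inj_onI) (auto simp: monotone_linear_orders_def order_on_defs)
      moreover have "M - {e} \<subset> M"
        using \<open>e \<in> T\<close> T by auto
      then have "card (?L (M - {e})) = ?f (M - {e})"
        using psubset.IH[of "M - {e}"] psubset.prems by blast
      ultimately show "card ((\<lambda>s. s \<union> M \<times> {e}) ` ?L (M - {e})) = ?f (M - {e})"
        by (simp add: card_image)
    qed
    finally have "card T * card (?L M) = (\<Sum>e\<in>T. card T * ?f (M - {e}))"
      by (simp add: sum_distrib_left)
    also have "\<dots> = (\<Sum>e\<in>T. ?f M)"
    proof (rule sum.cong[OF refl])
      fix e assume e: "e \<in> T"
      then have "insert e (M - {e}) = M" "{x\<in>M. \<delta> x = \<delta> e} = T" "\<delta> e \<in> V"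
        using T psubset.prems by (auto simp: T_def)
      then show "card T * ?f (M - {e}) = ?f M"
        using prod_fact_fibers_insert[of "M - {e}" e V \<delta>] psubset.hyps assms(2) by simp
    qed
    finally show ?thesis
      using T by (simp add: card_gt_0_iff)
  qed
qed


section \<open>Orderings with prescribed positions of the new vertices\<close>

text \<open>
  The positions of all new vertices, including those on short edges, are prescribed, so that the
  consistent orderings of an extended graph are an instance.
\<close>
definition placed_orderings :: "'e multigraph \<Rightarrow> ('e \<Rightarrow> nat) \<Rightarrow> 'e sub_vertex rel set" where
  "placed_orderings H \<delta> = {r \<in> orderings H. \<forall>e\<in>edges H.
     (Vtx (\<delta> e), Mid e) \<in> r \<and> (Mid e, Vtx (\<delta> e + 1)) \<in> r}"

fun merged_le :: "'e set \<Rightarrow> ('e \<Rightarrow> nat) \<Rightarrow> 'e rel \<Rightarrow> 'e sub_vertex \<Rightarrow> 'e sub_vertex \<Rightarrow> bool" where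
  "merged_le M \<delta> s (Vtx i) (Vtx j) \<longleftrightarrow> i \<le> j"
| "merged_le M \<delta> s (Vtx i) (Mid e) \<longleftrightarrow> e \<in> M \<and> i \<le> \<delta> e"
| "merged_le M \<delta> s (Mid e) (Vtx j) \<longleftrightarrow> e \<in> M \<and> \<delta> e < j"
| "merged_le M \<delta> s (Mid e) (Mid e') \<longleftrightarrow> (e, e') \<in> s"

text \<open>
  For a linear order \<open>s\<close> along which \<open>\<delta>\<close> is monotone, the only
  ordering that induces \<open>s\<close> on the new vertices and puts each of them into its
  interval.
\<close>
definition merged_order :: "'e set \<Rightarrow> ('e \<Rightarrow> nat) \<Rightarrow> 'e rel \<Rightarrow> 'e sub_vertex rel" where
  "merged_order M \<delta> s = {(u, v). merged_le M \<delta> s u v}"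

lemma linear_merged_order:
  assumes "s \<in> monotone_linear_orders (edges H) \<delta>"
  shows "linear_order_on (sub_verts H) (merged_order (edges H) \<delta> s)"
proof -
  let ?le = "merged_le (edges H) \<delta> s"
  have s: "s \<subseteq> edges H \<times> edges H" "\<And>e. e \<in> edges H \<Longrightarrow> (e, e) \<in> s" "trans s" "antisym s"
      "total_on (edges H) s" and mono: "\<And>e e'. (e, e') \<in> s \<Longrightarrow> \<delta> e \<le> \<delta> e'"
    using assms by (auto simp: monotone_linear_orders_def order_on_defs refl_on_def)
  have sub: "u \<in> sub_verts H \<and> v \<in> sub_verts H" if "?le u v" for u v
    using that s(1) by (cases u; cases v) (auto simp: sub_verts_def)
  have refl: "?le u u" if "u \<in> sub_verts H" for u
    using that s(2) by (cases u) (auto simp: sub_verts_def)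
  have strict: "(e, e') \<in> s" if "e \<in> edges H" "e' \<in> edges H" "\<delta> e < \<delta> e'" for e e'
    using s(5) that mono[of e' e] by (force simp: total_on_def)
  have trans: "?le u w" if "?le u v" "?le v w" for u v w
    using that s(1) by (cases u; cases v; cases w) (auto dest: mono transD[OF s(3)] intro: strict)
  have antisym: "u = v" if "?le u v" "?le v u" for u v
    using that by (cases u; cases v) (auto dest: antisymD[OF s(4)])
  have total: "?le u v \<or> ?le v u" if "u \<in> sub_verts H" "v \<in> sub_verts H" for u v
  proof -
    have "(e, e') \<in> s \<or> (e', e) \<in> s" if "e \<in> edges H" "e' \<in> edges H" for e e'
      using that s(2) s(5) by (cases "e = e'") (auto simp: total_on_def)
    then show ?thesis
      using that by (cases u; cases v) (auto simp: sub_verts_def)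
  qed
  show ?thesis
    unfolding order_on_defs refl_on_def trans_def antisym_def total_on_def merged_order_def
    using sub refl trans antisym total by blast
qed

text \<open>
  Such an ordering is the same as its restriction to the new vertices, a linear order along which
  the intervals increase weakly: the comparisons with the vertices \<open>Vtx i\<close> are
  forced.
\<close>
lemma card_placed_orderings:
  assumes H: "finite (edges H)" and \<delta>: "\<And>e. e \<in> edges H \<Longrightarrow> lies_over H e (\<delta> e)"
    and V: "finite V" "\<delta> ` edges H \<subseteq> V"
  shows "finite (placed_orderings H \<delta>)"
    and "card (placed_orderings H \<delta>) = (\<Prod>v\<in>V. fact (card {e\<in>edges H. \<delta> e = v}))"
proof -
  let ?m = "merged_order (edges H) \<delta>"
  let ?L = "monotone_linear_orders (edges H) \<delta>"
  have "?m ` ?L = placed_orderings H \<delta>"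
  proof (intro equalityI subsetI)
    fix r assume "r \<in> ?m ` ?L"
    then obtain s where "s \<in> ?L" "r = ?m s"
      by auto
    then show "r \<in> placed_orderings H \<delta>"
      using linear_merged_order[of s H \<delta>] \<delta>
      by (auto simp: placed_orderings_def orderings_def merged_order_def lies_over_def Suc_le_eq)
  next
    fix r assume "r \<in> placed_orderings H \<delta>"
    then have lin: "linear_order_on (sub_verts H) r"
      and vtx: "\<And>i j. i \<le> j \<Longrightarrow> (Vtx i, Vtx j) \<in> r"
      and mid: "\<And>e. e \<in> edges H \<Longrightarrow> (Vtx (\<delta> e), Mid e) \<in> r"
        "\<And>e. e \<in> edges H \<Longrightarrow> (Mid e, Vtx (\<delta> e + 1)) \<in> r"
      by (auto simp: placed_orderings_def orderings_def)
    have sub: "r \<subseteq> sub_verts H \<times> sub_verts H" and tr: "trans r" and as: "antisym r"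
      using lin by (auto simp: order_on_defs)
    have Mid_edge: "(Mid e, v) \<in> r \<Longrightarrow> e \<in> edges H" "(v, Mid e) \<in> r \<Longrightarrow> e \<in> edges H" for e v
      using sub by (auto simp: sub_verts_def)
    have r_le: "(Vtx i, Vtx j) \<in> r \<longleftrightarrow> i \<le> j" for i j
      using vtx[of j i] vtx[of i j] antisymD[OF as, of "Vtx i" "Vtx j"] by (cases "i \<le> j") auto
    have vm: "(Vtx i, Mid e) \<in> r \<longleftrightarrow> e \<in> edges H \<and> i \<le> \<delta> e" for i e
    proof -
      have "e \<in> edges H \<and> i \<le> \<delta> e" if "(Vtx i, Mid e) \<in> r"
        using transD[OF tr that mid(2)] antisymD[OF as that] Mid_edge that r_le
        by (metis Suc_eq_plus1 le_SucE mid(2) sub_vertex.distinct(1))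
      moreover have "(Vtx i, Mid e) \<in> r" if "e \<in> edges H" "i \<le> \<delta> e"
        using transD[OF tr vtx[OF that(2)] mid(1)[OF that(1)]] .
      ultimately show ?thesis
        by blast
    qed
    have mv: "(Mid e, Vtx j) \<in> r \<longleftrightarrow> e \<in> edges H \<and> \<delta> e < j" for j e
    proof -
      have "\<not> j \<le> \<delta> e" if "(Mid e, Vtx j) \<in> r"
        using antisymD[OF as that] vm[of j e] Mid_edge that by auto
      moreover have "(Mid e, Vtx j) \<in> r" if "e \<in> edges H" "\<delta> e < j"
        by (rule transD[OF tr mid(2)[OF that(1)] vtx]) (use that in simp)
      ultimately show ?thesis
        using Mid_edge by (auto simp: not_le)
    qed
    define s where "s = {(e, e'). (Mid e, Mid e') \<in> r}"
    have "linear_order_on (edges H) s"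
    proof -
      have "(e, e) \<in> s" if "e \<in> edges H" for e
        using that lin by (auto simp: s_def order_on_defs refl_on_def sub_verts_def)
      moreover have "(e, e') \<in> s \<or> (e', e) \<in> s" if "e \<in> edges H" "e' \<in> edges H" "e \<noteq> e'" for e e'
        using that lin by (auto simp: s_def order_on_defs total_on_def sub_verts_def)
      moreover have "trans s"
        using tr unfolding trans_def s_def by blast
      moreover have "antisym s"
        using as unfolding antisym_def s_def by blast
      moreover have "s \<subseteq> edges H \<times> edges H"
        using Mid_edge by (auto simp: s_def)
      ultimately show ?thesis
        by (auto simp: order_on_defs refl_on_def total_on_def)
    qed
    moreover have "\<delta> e \<le> \<delta> e'" if "(e, e') \<in> s" for e e'
      using vm[of "\<delta> e" e'] vm[of "\<delta> e" e] Mid_edge that transD[OF tr] unfolding s_def by blast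
    ultimately have "s \<in> ?L"
      by (auto simp: monotone_linear_orders_def)
    moreover have "(u, v) \<in> r \<longleftrightarrow> merged_le (edges H) \<delta> s u v" for u v
      by (cases u; cases v) (simp_all add: r_le vm mv s_def)
    then have "?m s = r"
      by (auto simp: merged_order_def)
    ultimately show "r \<in> ?m ` ?L"
      by blast
  qed
  moreover have "inj_on ?m ?L"
  proof (rule inj_onI)
    fix s s' assume "?m s = ?m s'"
    then have "merged_le (edges H) \<delta> s (Mid e) (Mid e') = merged_le (edges H) \<delta> s' (Mid e) (Mid e')"
      for e e'
      unfolding merged_order_def by (metis (no_types, lifting) case_prodD case_prodI mem_Collect_eq)
    then show "s = s'"
      by auto
  qed
  ultimately show "finite (placed_orderings H \<delta>)"
      "card (placed_orderings H \<delta>) = (\<Prod>v\<in>V. fact (card {e\<in>edges H. \<delta> e = v}))"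
    using finite_monotone_linear_orders[OF H, of \<delta>] card_monotone_linear_orders[OF H V]
    by (metis finite_imageI, metis card_image)
qed


section \<open>Automorphisms fixing the vertices 0, 1, 2, ...\<close>

definition relabel :: "('e \<Rightarrow> 'e) \<Rightarrow> 'e sub_vertex rel \<Rightarrow> 'e sub_vertex rel" where
  "relabel \<pi> r = map_prod (map_sub_vertex \<pi>) (map_sub_vertex \<pi>) ` r"

text \<open>
  The edge permutations that induce the automorphisms of the subdivided graph fixing the vertices
  0, 1, 2, ... and the new vertices on \<open>X\<close>.
\<close>
definition edge_perms :: "'e multigraph \<Rightarrow> 'e set \<Rightarrow> ('e \<Rightarrow> 'e) set" where
  "edge_perms H X = {\<pi>. \<pi> permutes edges H \<and>
     (\<forall>e\<in>edges H. lft H (\<pi> e) = lft H e \<and> rgt H (\<pi> e) = rgt H e \<and> wgt H (\<pi> e) = wgt H e) \<and>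
     (\<forall>e\<in>X. \<pi> e = e)}"

lemma relabel_relabel: "relabel \<pi> (relabel \<sigma> r) = relabel (\<pi> \<circ> \<sigma>) r"
  by (simp add: relabel_def image_image map_prod.compositionality sub_vertex.map_comp comp_def
      map_prod_def case_prod_beta)

lemma relabel_id [simp]: "relabel id r = r"
  by (simp add: relabel_def sub_vertex.map_id0 map_prod.id)

lemma relabel_mem_iff:
  assumes "inj \<pi>"
  shows "(map_sub_vertex \<pi> u, map_sub_vertex \<pi> v) \<in> relabel \<pi> r \<longleftrightarrow> (u, v) \<in> r"
  using sub_vertex.inj_map[OF assms] unfolding relabel_def by (auto dest: injD)

lemma edge_perms_comp: "\<pi> \<in> edge_perms H X \<Longrightarrow> \<sigma> \<in> edge_perms H X \<Longrightarrow> \<pi> \<circ> \<sigma> \<in> edge_perms H X"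
  by (auto simp: edge_perms_def permutes_compose permutes_in_image)

lemma edge_perms_inv:
  assumes "\<pi> \<in> edge_perms H X"
  shows "inv \<pi> \<in> edge_perms H X"
proof -
  have p: "\<pi> permutes edges H"
    using assms by (simp add: edge_perms_def)
  have eq: "\<pi> (inv \<pi> e) = e" for e
    using permutes_inverses(1)[OF p] .
  have "inv \<pi> e \<in> edges H" if "e \<in> edges H" for e
    using permutes_in_image[OF permutes_inv[OF p]] that by simp
  moreover have "inv \<pi> e = e" if "\<pi> e = e" for e
    using permutes_inv_eq[OF p] that by simp
  moreover have "lft H (inv \<pi> e) = lft H e \<and> rgt H (inv \<pi> e) = rgt H e \<and> wgt H (inv \<pi> e) = wgt H e"
    if "inv \<pi> e \<in> edges H" for e
  proof -
    have "\<forall>x\<in>edges H. lft H (\<pi> x) = lft H x \<and> rgt H (\<pi> x) = rgt H x \<and> wgt H (\<pi> x) = wgt H x"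
      using assms by (simp add: edge_perms_def)
    from bspec[OF this that] show ?thesis
      by (simp add: eq)
  qed
  ultimately show ?thesis
    using assms permutes_inv[OF p] by (simp add: edge_perms_def)
qed

lemma edge_perms_id: "id \<in> edge_perms H X"
  by (simp add: edge_perms_def permutes_id)

lemma relabel_orderings:
  assumes \<pi>: "\<pi> \<in> edge_perms H X" and r: "r \<in> orderings H"
  shows "relabel \<pi> r \<in> orderings H"
proof -
  let ?f = "map_sub_vertex \<pi>"
  have p: "\<pi> permutes edges H"
    using \<pi> by (simp add: edge_perms_def)
  have img: "?f ` sub_verts H = sub_verts H"
    unfolding sub_verts_def image_Un image_image
    by (simp add: image_image[of Mid \<pi>, symmetric] permutes_image[OF p])
  have mem: "(?f u, ?f v) \<in> relabel \<pi> r \<longleftrightarrow> (u, v) \<in> r" for u v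
    by (rule relabel_mem_iff[OF permutes_inj[OF p]])
  have lin: "linear_order_on (sub_verts H) r"
    and vtx: "\<And>i j. i \<le> j \<Longrightarrow> (Vtx i, Vtx j) \<in> r"
    and mid: "\<And>e. e \<in> edges H \<Longrightarrow> (Vtx (lft H e), Mid e) \<in> r"
        "\<And>e. e \<in> edges H \<Longrightarrow> (Mid e, Vtx (rgt H e)) \<in> r"
    using r by (auto simp: orderings_def)
  have r': "r \<subseteq> sub_verts H \<times> sub_verts H" "refl_on (sub_verts H) r" "trans r" "antisym r"
      "total_on (sub_verts H) r"
    using lin by (auto simp: order_on_defs)
  have "linear_order_on (sub_verts H) (relabel \<pi> r)"
  proof -
    have sub: "relabel \<pi> r \<subseteq> sub_verts H \<times> sub_verts H"
      using r'(1) img unfolding relabel_def by fastforce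
    have ex: "\<exists>u'. u = ?f u' \<and> u' \<in> sub_verts H" if "u \<in> sub_verts H" for u
      using img that by blast
    have "refl_on (sub_verts H) (relabel \<pi> r)"
      using r'(2) mem ex unfolding refl_on_def by metis
    moreover have "total_on (sub_verts H) (relabel \<pi> r)"
      using r'(5) mem ex unfolding total_on_def by metis
    moreover have "trans (relabel \<pi> r)"
    proof (rule transI)
      fix u v w assume uv: "(u, v) \<in> relabel \<pi> r" and vw: "(v, w) \<in> relabel \<pi> r"
      obtain u' v' w' where "u = ?f u'" "v = ?f v'" "w = ?f w'"
        using uv vw unfolding relabel_def by auto
      then show "(u, w) \<in> relabel \<pi> r"
        using uv vw transD[OF r'(3)] by (auto simp: mem)
    qed
    moreover have "antisym (relabel \<pi> r)"
    proof (rule antisymI)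
      fix u v assume uv: "(u, v) \<in> relabel \<pi> r" and vu: "(v, u) \<in> relabel \<pi> r"
      obtain u' v' where "u = ?f u'" "v = ?f v'"
        using uv unfolding relabel_def by auto
      then show "u = v"
        using uv vu antisymD[OF r'(4)] by (auto simp: mem)
    qed
    ultimately show ?thesis
      using sub by (simp add: order_on_defs)
  qed
  moreover have "(Vtx i, Vtx j) \<in> relabel \<pi> r" if "i \<le> j" for i j
    using mem[of "Vtx i" "Vtx j"] vtx[OF that] by simp
  moreover have "(Vtx (lft H e), Mid e) \<in> relabel \<pi> r \<and> (Mid e, Vtx (rgt H e)) \<in> relabel \<pi> r"
    if e: "e \<in> edges H" for e
  proof -
    obtain e' where e': "e' \<in> edges H" "e = \<pi> e'"
      using permutes_image[OF p] e by blast
    then have "lft H e = lft H e'" "rgt H e = rgt H e'"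
      using \<pi> by (auto simp: edge_perms_def)
    then show ?thesis
      using mem[of "Vtx (lft H e')" "Mid e'"] mem[of "Mid e'" "Vtx (rgt H e')"] mid[OF e'(1)] e'(2)
      by simp
  qed
  ultimately show ?thesis
    by (simp add: orderings_def)
qed

text \<open>
  The action is free: a new vertex is determined by its rank among the new vertices, and
  relabelling carries ranks along.
\<close>
lemma relabel_inj_on:
  assumes H: "finite (edges H)" and r: "r \<in> orderings H"
  shows "inj_on (\<lambda>\<pi>. relabel \<pi> r) (edge_perms H X)"
proof (rule inj_onI)
  fix \<pi> \<sigma> assume \<pi>: "\<pi> \<in> edge_perms H X" and \<sigma>: "\<sigma> \<in> edge_perms H X" and eq: "relabel \<pi> r = relabel \<sigma> r"
  define rank where "rank s e = card {e'\<in>edges H. (Mid e', Mid e) \<in> s}"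
    for s :: "'a sub_vertex rel" and e
  have rank_relabel: "rank (relabel \<tau> r) (\<tau> e) = rank r e" if "\<tau> \<in> edge_perms H X" for \<tau> e
  proof -
    have p: "\<tau> permutes edges H"
      using that by (simp add: edge_perms_def)
    have mem: "(Mid (\<tau> x), Mid (\<tau> e)) \<in> relabel \<tau> r \<longleftrightarrow> (Mid x, Mid e) \<in> r" for x
      using relabel_mem_iff[OF permutes_inj[OF p], of "Mid x" "Mid e"] by simp
    have "{e'\<in>edges H. (Mid e', Mid (\<tau> e)) \<in> relabel \<tau> r} = \<tau> ` {e'\<in>edges H. (Mid e', Mid e) \<in> r}"
    proof (intro equalityI subsetI)
      fix y assume y: "y \<in> {e'\<in>edges H. (Mid e', Mid (\<tau> e)) \<in> relabel \<tau> r}"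
      then obtain x where "x \<in> edges H" "y = \<tau> x"
        using permutes_image[OF p] by blast
      then show "y \<in> \<tau> ` {e'\<in>edges H. (Mid e', Mid e) \<in> r}"
        using y mem by auto
    qed (auto simp: mem permutes_in_image[OF p])
    then show ?thesis
      unfolding rank_def using permutes_inj_on[OF p] by (simp add: card_image)
  qed
  have rank_inj: "e = e'"
    if "s \<in> orderings H" "e \<in> edges H" "e' \<in> edges H" "rank s e = rank s e'" for s e e'
  proof -
    have s: "trans s" "antisym s" "refl_on (sub_verts H) s" "total_on (sub_verts H) s"
      using that(1) by (auto simp: orderings_def order_on_defs)
    have less: "rank s x < rank s y" if "(Mid x, Mid y) \<in> s" "x \<noteq> y" "y \<in> edges H" for x y
      unfolding rank_def
    proof (rule psubset_card_mono)
      have "(Mid y, Mid y) \<in> s" "(Mid y, Mid x) \<notin> s"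
        using s that antisymD[OF s(2) that(1)] by (auto simp: refl_on_def sub_verts_def)
      then show "{e'\<in>edges H. (Mid e', Mid x) \<in> s} \<subset> {e'\<in>edges H. (Mid e', Mid y) \<in> s}"
        using that transD[OF s(1) _ that(1)] by blast
    qed (use H in simp)
    have "Mid e \<in> sub_verts H" "Mid e' \<in> sub_verts H"
      using that by (auto simp: sub_verts_def)
    then have "e = e' \<or> (Mid e, Mid e') \<in> s \<or> (Mid e', Mid e) \<in> s"
      using s(4) by (auto simp: total_on_def)
    then show ?thesis
      using less[of e e'] less[of e' e] that by auto
  qed
  have p: "\<pi> permutes edges H" "\<sigma> permutes edges H"
    using \<pi> \<sigma> by (auto simp: edge_perms_def)
  show "\<pi> = \<sigma>"
  proof
    fix e
    show "\<pi> e = \<sigma> e"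
    proof (cases "e \<in> edges H")
      case True
      have "rank (relabel \<pi> r) (\<pi> e) = rank (relabel \<pi> r) (\<sigma> e)"
        using rank_relabel[OF \<pi>, of e] rank_relabel[OF \<sigma>, of e] eq by simp
      then show ?thesis
        using rank_inj[OF relabel_orderings[OF \<pi> r]] True p by (simp add: permutes_in_image)
    next
      case False
      then show ?thesis
        using p by (simp add: permutes_not_in)
    qed
  qed
qed

lemma sub_automorphism_map_sub_vertex:
  assumes "\<pi> \<in> edge_perms H X"
  shows "sub_automorphism H (map_sub_vertex \<pi>)"
proof -
  let ?f = "map_sub_vertex \<pi>"
  have p: "\<pi> permutes edges H"
    using assms by (simp add: edge_perms_def)
  have "?f ` sub_verts H = sub_verts H"
    unfolding sub_verts_def image_Un image_image
    by (simp add: image_image[of Mid \<pi>, symmetric] permutes_image[OF p])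
  then have "bij_betw ?f (sub_verts H) (sub_verts H)"
    using sub_vertex.inj_map[OF permutes_inj[OF p]]
    by (auto simp: bij_betw_def intro: inj_on_subset)
  moreover have "(\<lambda>(S, w). (?f ` S, w)) ` sub_edges H = sub_edges H"
  proof -
    let ?E = "\<lambda>e. {({Vtx (lft H e), Mid e}, wgt H e), ({Mid e, Vtx (rgt H e)}, wgt H e)}"
    have "(\<lambda>(S, w). (?f ` S, w)) ` sub_edges H = (\<Union>e\<in>edges H. ?E (\<pi> e))"
      unfolding sub_edges_def image_UN using assms by (intro SUP_cong) (auto simp: edge_perms_def)
    also have "\<dots> = (\<Union>e\<in>\<pi> ` edges H. ?E e)"
      by simp
    also have "\<dots> = sub_edges H"
      unfolding sub_edges_def by (simp add: permutes_image[OF p])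
    finally show ?thesis .
  qed
  ultimately show ?thesis
    by (simp add: sub_automorphism_def)
qed

text \<open>
  The two edges at a new vertex lead to its fixed neighbours, which are the endpoints of the
  subdivided edge. As the left endpoint is the smaller one, an automorphism cannot exchange the
  two roles.
\<close>
lemma sub_automorphism_fixing_vertices:
  assumes H: "finite (edges H)" "\<And>e. e \<in> edges H \<Longrightarrow> lft H e < rgt H e"
    and X: "X \<subseteq> edges H"
    and f: "sub_automorphism H f" "\<And>v. v \<in> range Vtx \<union> Mid ` X \<Longrightarrow> f v = v"
  obtains \<pi> where "\<pi> \<in> edge_perms H X" "\<And>v. v \<in> sub_verts H \<Longrightarrow> f v = map_sub_vertex \<pi> v"
proof -
  have bij: "bij_betw f (sub_verts H) (sub_verts H)"
    and E: "(\<lambda>(S, w). (f ` S, w)) ` sub_edges H = sub_edges H"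
    using f(1) by (auto simp: sub_automorphism_def)
  have inj: "inj_on f (sub_verts H)"
    using bij by (rule bij_betw_imp_inj_on)
  have fV: "f (Vtx i) = Vtx i" for i
    using f(2) by auto
  have "\<exists>e'\<in>edges H. f (Mid e) = Mid e'" if e: "e \<in> edges H" for e
  proof -
    have "f (Mid e) \<in> sub_verts H"
      using bij_betw_imp_surj_on[OF bij] e by (auto simp: sub_verts_def)
    moreover have "f (Mid e) \<noteq> Vtx i" for i
      using inj_onD[OF inj, of "Mid e" "Vtx i"] fV[of i] e by (auto simp: sub_verts_def)
    ultimately show ?thesis
      by (auto simp: sub_verts_def)
  qed
  then obtain q where q: "\<And>e. e \<in> edges H \<Longrightarrow> q e \<in> edges H \<and> f (Mid e) = Mid (q e)"
    by metis
  define \<pi> where "\<pi> e = (if e \<in> edges H then q e else e)" for e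
  have \<pi>: "\<pi> e \<in> edges H" "f (Mid e) = Mid (\<pi> e)" if "e \<in> edges H" for e
    using q that by (auto simp: \<pi>_def)
  have "inj_on \<pi> (edges H)"
  proof (rule inj_onI)
    fix x y assume "x \<in> edges H" "y \<in> edges H" "\<pi> x = \<pi> y"
    then show "x = y"
      using inj_onD[OF inj, of "Mid x" "Mid y"] \<pi>(2) by (auto simp: sub_verts_def)
  qed
  then have "bij_betw \<pi> (edges H) (edges H)"
    using endo_inj_surj[OF H(1)] \<pi>(1) by (auto simp: bij_betw_def)
  then have p: "\<pi> permutes edges H"
    by (rule bij_imp_permutes) (simp add: \<pi>_def)
  have image_E: "(f ` S, w) \<in> sub_edges H" if "(S, w) \<in> sub_edges H" for S w
    using imageI[OF that, of "\<lambda>(S, w). (f ` S, w)"] unfolding E by simp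
  have "lft H (\<pi> e) = lft H e \<and> rgt H (\<pi> e) = rgt H e \<and> wgt H (\<pi> e) = wgt H e"
    if e: "e \<in> edges H" for e
  proof -
    have "({Vtx (lft H e), Mid e}, wgt H e) \<in> sub_edges H"
      "({Mid e, Vtx (rgt H e)}, wgt H e) \<in> sub_edges H"
      using e by (auto simp: sub_edges_def)
    then have "({Vtx (lft H e), Mid (\<pi> e)}, wgt H e) \<in> sub_edges H"
      "({Mid (\<pi> e), Vtx (rgt H e)}, wgt H e) \<in> sub_edges H"
      using image_E[of "{Vtx (lft H e), Mid e}"] image_E[of "{Mid e, Vtx (rgt H e)}"]
      by (simp_all add: fV \<pi>(2)[OF e])
    then have "(lft H e = lft H (\<pi> e) \<or> lft H e = rgt H (\<pi> e)) \<and> wgt H e = wgt H (\<pi> e)"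
      "rgt H e = lft H (\<pi> e) \<or> rgt H e = rgt H (\<pi> e)"
      by (auto simp: sub_edges_def doubleton_eq_iff)
    then show ?thesis
      using H(2)[OF e] H(2)[OF \<pi>(1)[OF e]] by auto
  qed
  moreover have "\<pi> e = e" if "e \<in> X" for e
    using f(2)[of "Mid e"] \<pi>(2)[of e] that X by auto
  ultimately have "\<pi> \<in> edge_perms H X"
    using p by (simp add: edge_perms_def)
  moreover have "f v = map_sub_vertex \<pi> v" if "v \<in> sub_verts H" for v
    using that by (cases v) (auto simp: fV \<pi>(2) sub_verts_def)
  ultimately show thesis
    using that by blast
qed

lemma ordering_equiv_class:
  assumes H: "finite (edges H)" "\<And>e. e \<in> edges H \<Longrightarrow> lft H e < rgt H e"
    and X: "X \<subseteq> edges H" and r: "r \<in> orderings H"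
  shows "ordering_equiv H (range Vtx \<union> Mid ` X) `` {r} = (\<lambda>\<pi>. relabel \<pi> r) ` edge_perms H X"
proof (intro equalityI subsetI)
  fix r' assume "r' \<in> ordering_equiv H (range Vtx \<union> Mid ` X) `` {r}"
  then obtain f where f: "sub_automorphism H f" "\<And>v. v \<in> range Vtx \<union> Mid ` X \<Longrightarrow> f v = v"
    and r': "r' = map_prod f f ` r"
    by (auto simp: ordering_equiv_def)
  obtain \<pi> where \<pi>: "\<pi> \<in> edge_perms H X" "\<And>v. v \<in> sub_verts H \<Longrightarrow> f v = map_sub_vertex \<pi> v"
    using sub_automorphism_fixing_vertices[OF H X f] by metis
  have "r \<subseteq> sub_verts H \<times> sub_verts H"
    using r by (auto simp: orderings_def order_on_defs)
  then have "r' = relabel \<pi> r"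
    unfolding r' relabel_def by (intro image_cong) (auto simp: \<pi>(2))
  then show "r' \<in> (\<lambda>\<pi>. relabel \<pi> r) ` edge_perms H X"
    using \<pi>(1) by auto
next
  fix r' assume "r' \<in> (\<lambda>\<pi>. relabel \<pi> r) ` edge_perms H X"
  then obtain \<pi> where \<pi>: "\<pi> \<in> edge_perms H X" and r': "r' = relabel \<pi> r"
    by auto
  have "\<forall>v\<in>range Vtx \<union> Mid ` X. map_sub_vertex \<pi> v = v"
    using \<pi> by (auto simp: edge_perms_def)
  then show "r' \<in> ordering_equiv H (range Vtx \<union> Mid ` X) `` {r}"
    using sub_automorphism_map_sub_vertex[OF \<pi>] relabel_orderings[OF \<pi> r] r r'
    unfolding ordering_equiv_def relabel_def by blast
qed

text \<open>
  The equivalence classes are the orbits of a free action, so they all have the size of the group.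
\<close>
lemma card_ordering_classes:
  assumes H: "finite (edges H)" "\<And>e. e \<in> edges H \<Longrightarrow> lft H e < rgt H e"
    and X: "X \<subseteq> edges H"
    and R: "finite R" "R \<subseteq> orderings H"
      "\<And>\<pi> r. \<pi> \<in> edge_perms H X \<Longrightarrow> r \<in> R \<Longrightarrow> relabel \<pi> r \<in> R"
  shows "card (edge_perms H X) * card (R // ordering_equiv H (range Vtx \<union> Mid ` X)) = card R"
proof -
  let ?P = "edge_perms H X"
  define orb where "orb r = (\<lambda>\<pi>. relabel \<pi> r) ` ?P" for r
  have quot: "R // ordering_equiv H (range Vtx \<union> Mid ` X) = orb ` R"
    unfolding quotient_def orb_def using ordering_equiv_class[OF H X] R(2) by blast
  have union: "\<Union>(orb ` R) = R"
  proof
    show "\<Union>(orb ` R) \<subseteq> R"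
      using R(3) by (auto simp: orb_def)
    show "R \<subseteq> \<Union>(orb ` R)"
    proof
      fix r assume "r \<in> R"
      moreover have "r \<in> orb r"
        unfolding orb_def by (rule image_eqI[of _ _ id]) (simp_all add: edge_perms_id)
      ultimately show "r \<in> \<Union>(orb ` R)"
        by blast
    qed
  qed
  have orb_relabel: "orb (relabel \<pi> r) = orb r" if \<pi>: "\<pi> \<in> ?P" for \<pi> r
  proof (intro equalityI subsetI)
    fix s assume "s \<in> orb (relabel \<pi> r)"
    then obtain \<sigma> where "\<sigma> \<in> ?P" "s = relabel (\<sigma> \<circ> \<pi>) r"
      by (auto simp: orb_def relabel_relabel)
    then show "s \<in> orb r"
      using edge_perms_comp[OF _ \<pi>] unfolding orb_def by blast
  next
    fix s assume "s \<in> orb r"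
    then obtain \<sigma> where \<sigma>: "\<sigma> \<in> ?P" "s = relabel \<sigma> r"
      by (auto simp: orb_def)
    have "\<sigma> \<circ> inv \<pi> \<circ> \<pi> = \<sigma>"
      using permutes_inv_o(2)[of \<pi> "edges H"] \<pi> by (simp add: comp_assoc edge_perms_def)
    then have "s = relabel (\<sigma> \<circ> inv \<pi>) (relabel \<pi> r)"
      using \<sigma> by (simp add: relabel_relabel)
    then show "s \<in> orb (relabel \<pi> r)"
      using edge_perms_comp[OF \<sigma>(1) edge_perms_inv[OF \<pi>]] unfolding orb_def by blast
  qed
  have "card ?P * card (orb ` R) = card (\<Union>(orb ` R))"
  proof (rule card_partition)
    show "finite (orb ` R)" "finite (\<Union>(orb ` R))"
      using R(1) union by simp_all
    show "card c = card ?P" if "c \<in> orb ` R" for c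
      using that R(2) relabel_inj_on[OF H(1)] by (auto simp: orb_def intro!: card_image)
    show "c \<inter> c' = {}" if "c \<in> orb ` R" "c' \<in> orb ` R" "c \<noteq> c'" for c c'
    proof (rule ccontr)
      assume "c \<inter> c' \<noteq> {}"
      then obtain s where "s \<in> c" "s \<in> c'"
        by auto
      moreover have "orb s = d" if d: "s \<in> d" "d \<in> orb ` R" for d
      proof -
        obtain x \<pi> where "d = orb x" "\<pi> \<in> ?P" "s = relabel \<pi> x"
          using d unfolding orb_def by blast
        then show ?thesis
          using orb_relabel by simp
      qed
      ultimately show False
        using that by metis
    qed
  qed
  then show ?thesis
    unfolding quot union .
qed


section \<open>The counting functions N and N*\<close>

lemma edges_ext: "edges (ext d G) = Long ` edges G \<union> (\<Union>i\<le>d. Short i ` {..<i - wsum G i})"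
  by (auto simp: ext_def)

lemma finite_edges_ext: "finite (edges G) \<Longrightarrow> finite (edges (ext d G))"
  by (simp add: edges_ext)

lemma lft_less_rgt_ext:
  "long_edge_graph G \<Longrightarrow> e \<in> edges (ext d G) \<Longrightarrow> lft (ext d G) e < rgt (ext d G) e"
  by (auto simp: ext_def long_edge_graph_def)

lemma rgt_le_if_allowable:
  assumes "long_edge_graph G" "allowable d G" "e \<in> edges G"
  shows "rgt G e \<le> d + 1"
proof (rule ccontr)
  assume "\<not> rgt G e \<le> d + 1"
  then have "card {x\<in>edges G. incident G x (rgt G e)} = 0"
    using assms(2) by (simp add: allowable_def degree_def)
  moreover have "finite {x\<in>edges G. incident G x (rgt G e)}"
    using assms(1) by (simp add: long_edge_graph_def)
  ultimately have "{x\<in>edges G. incident G x (rgt G e)} = {}"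
    by simp
  then show False
    using assms(3) by (auto simp: incident_def)
qed

text \<open>
  Fixing the edges of \<open>G\<close> leaves the permutations of the parallel short edges over
  each interval.
\<close>
lemma card_edge_perms_short:
  assumes "finite (edges G)"
  shows "card (edge_perms (ext d G) (Long ` edges G)) = (\<Prod>i\<le>d. fact (i - wsum G i))"
proof -
  let ?H = "ext d G"
  \<comment> \<open>preserving \<open>c\<close> means fixing every \<open>Long e\<close> and permuting the short edges over each interval\<close>
  define c :: "'a ext_edge \<Rightarrow> 'a + nat"
    where "c x = (case x of Long e \<Rightarrow> Inl e | Short i j \<Rightarrow> Inr i)" for x
  have c_simps: "c (Long e) = Inl e" "c (Short i j) = Inr i" for e i j
    by (simp_all add: c_def)
  have "edge_perms ?H (Long ` edges G) = {p. p permutes edges ?H \<and> (\<forall>x\<in>edges ?H. c (p x) = c x)}"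
  proof (intro equalityI subsetI CollectI conjI ballI)
    fix p x assume p: "p \<in> edge_perms ?H (Long ` edges G)" and x: "x \<in> edges ?H"
    have perm: "p permutes edges ?H" and fixed: "\<And>e. e \<in> edges G \<Longrightarrow> p (Long e) = Long e"
      and lft: "lft ?H (p x) = lft ?H x"
      using p x by (auto simp: edge_perms_def)
    show "c (p x) = c x"
    proof (cases x)
      case (Long e)
      then show ?thesis
        using x fixed by (auto simp: edges_ext)
    next
      case (Short i j)
      have "p x \<noteq> Long e" if "e \<in> edges G" for e
        using injD[OF permutes_inj[OF perm], of x "Long e"] fixed[OF that] Short by auto
      moreover have "p x \<in> edges ?H"
        using perm x by (simp add: permutes_in_image)
      ultimately obtain i' j' where "p x = Short i' j'"
        by (auto simp: edges_ext)
      then show ?thesis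
        using lft Short by (simp add: c_simps ext_def)
    qed
  next
    fix p assume p: "p \<in> {p. p permutes edges ?H \<and> (\<forall>x\<in>edges ?H. c (p x) = c x)}"
    have "p (Long e) = Long e" if "e \<in> edges G" for e
    proof -
      have "c (p (Long e)) = Inl e"
        using p that by (simp add: edges_ext c_simps)
      then show ?thesis
        by (cases "p (Long e)") (auto simp: c_simps)
    qed
    moreover have "\<exists>k. p (Short i j) = Short i k" if "Short i j \<in> edges ?H" for i j
    proof -
      have "c (p (Short i j)) = Inr i"
        using p that by (simp add: c_simps)
      then show ?thesis
        by (cases "p (Short i j)") (auto simp: c_simps)
    qed
    ultimately have "lft ?H (p x) = lft ?H x \<and> rgt ?H (p x) = rgt ?H x \<and> wgt ?H (p x) = wgt ?H x"
      if "x \<in> edges ?H" for x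
      using that by (cases x) (fastforce simp: ext_def)+
    then show "p \<in> edge_perms ?H (Long ` edges G)"
      using p \<open>\<And>e. e \<in> edges G \<Longrightarrow> p (Long e) = Long e\<close> by (auto simp: edge_perms_def)
  qed (auto simp: edge_perms_def)
  then have "card (edge_perms ?H (Long ` edges G))
      = (\<Prod>v\<in>Inl ` edges G \<union> Inr ` {..d}. fact (card {x\<in>edges ?H. c x = v}))"
    by (simp only:, intro card_permutes_preserving) (auto simp: assms finite_edges_ext edges_ext c_simps)
  also have "\<dots> = (\<Prod>v\<in>Inl ` edges G. fact (card {x\<in>edges ?H. c x = v})) *
      (\<Prod>v\<in>Inr ` {..d}. fact (card {x\<in>edges ?H. c x = v}))"
    by (rule prod.union_disjoint) (use assms in auto)
  also have "(\<Prod>v\<in>Inl ` edges G. fact (card {x\<in>edges ?H. c x = v}) :: nat) = 1"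
  proof (rule prod.neutral, rule ballI)
    fix v :: "'a + nat" assume "v \<in> Inl ` edges G"
    then obtain e where "e \<in> edges G" "v = Inl e"
      by auto
    then have "{x\<in>edges ?H. c x = v} = {Long e}"
      by (auto simp: edges_ext c_simps)
    then show "fact (card {x\<in>edges ?H. c x = v}) = (1 :: nat)"
      by simp
  qed
  also have "(\<Prod>v\<in>Inr ` {..d}. fact (card {x\<in>edges ?H. c x = v}) :: nat)
      = (\<Prod>i\<le>d. fact (card {x\<in>edges ?H. c x = Inr i}))"
    by (subst prod.reindex) auto
  also have "\<dots> = (\<Prod>i\<le>d. fact (i - wsum G i))"
  proof (rule prod.cong[OF refl])
    fix i assume "i \<in> {..d}"
    then have "{x\<in>edges ?H. c x = Inr i} = Short i ` {..<i - wsum G i}"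
      by (auto simp: edges_ext c_simps)
    then show "fact (card {x\<in>edges ?H. c x = Inr i}) = fact (i - wsum G i)"
      by (simp add: card_image inj_on_def)
  qed
  finally show ?thesis
    by simp
qed

lemma edge_perms_eq_preserving:
  "edge_perms H {} = {p. p permutes edges H \<and>
     (\<forall>e\<in>edges H. (lft H (p e), rgt H (p e), wgt H (p e)) = (lft H e, rgt H e, wgt H e))}"
  by (auto simp: edge_perms_def)

text \<open>
  An edge of \<open>G\<close> is not short, hence never exchanged with an added short edge, and
  the group is a direct product.
\<close>
lemma card_edge_perms_ext:
  assumes G: "long_edge_graph G"
  shows "card (edge_perms (ext d G) {}) = edge_symmetries G * (\<Prod>i\<le>d. fact (i - wsum G i))"
proof -
  let ?H = "ext d G"
  define c where "c e = (lft G e, rgt G e, wgt G e)" for e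
  define h where "h x = (lft ?H x, rgt ?H x, wgt ?H x)" for x
  have h_simps: "h (Long e) = c e" "h (Short i j) = (i, i + 1, 1)" for e i j
    by (simp_all add: h_def c_def ext_def)
  have fin: "finite (edges G)"
    using G by (simp add: long_edge_graph_def)
  have no_short: "c e \<noteq> (i, i + 1, 1)" if "e \<in> edges G" for e i
    using G that by (auto simp: long_edge_graph_def short_edge_def len_def c_def)
  let ?s = "\<lambda>i :: nat. (i, i + 1, 1 :: nat)"
  have "edge_symmetries G = card {p. p permutes edges G \<and> (\<forall>e\<in>edges G. c (p e) = c e)}"
    by (simp add: edge_symmetries_def c_def)
  also have "\<dots> = (\<Prod>v\<in>c ` edges G. fact (card {e\<in>edges G. c e = v}))"
    by (rule card_permutes_preserving) (use fin in auto)
  finally have sym: "edge_symmetries G = \<dots>" .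
  have "card (edge_perms ?H {}) = card {p. p permutes edges ?H \<and> (\<forall>x\<in>edges ?H. h (p x) = h x)}"
    unfolding edge_perms_eq_preserving h_def ..
  also have "\<dots> = (\<Prod>v\<in>c ` edges G \<union> ?s ` {..d}. fact (card {x\<in>edges ?H. h x = v}))"
    by (rule card_permutes_preserving) (auto simp: fin finite_edges_ext edges_ext h_simps)
  also have "\<dots> = (\<Prod>v\<in>c ` edges G. fact (card {x\<in>edges ?H. h x = v})) *
      (\<Prod>v\<in>?s ` {..d}. fact (card {x\<in>edges ?H. h x = v}))"
  proof (rule prod.union_disjoint)
    show "c ` edges G \<inter> ?s ` {..d} = {}"
    proof (rule equals0I)
      fix v assume "v \<in> c ` edges G \<inter> ?s ` {..d}"
      then obtain e i where "e \<in> edges G" "v = c e" "v = ?s i"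
        by auto
      then show False
        using no_short[of e i] by simp
    qed
  qed (use fin in auto)
  also have "(\<Prod>v\<in>c ` edges G. fact (card {x\<in>edges ?H. h x = v}) :: nat) =
      (\<Prod>v\<in>c ` edges G. fact (card {e\<in>edges G. c e = v}) :: nat)"
  proof (rule prod.cong[OF refl])
    fix v assume "v \<in> c ` edges G"
    then have "v \<noteq> ?s i" for i
      using no_short by auto
    then have "{x\<in>edges ?H. h x = v} = Long ` {e\<in>edges G. c e = v}"
      by (force simp: edges_ext h_simps)
    then show "fact (card {x\<in>edges ?H. h x = v}) = (fact (card {e\<in>edges G. c e = v}) :: nat)"
      by (simp add: card_image inj_on_def)
  qed
  also have "\<dots> = edge_symmetries G"
    by (simp add: sym)
  also have "(\<Prod>v\<in>?s ` {..d}. fact (card {x\<in>edges ?H. h x = v}) :: nat)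
      = (\<Prod>i\<le>d. fact (card {x\<in>edges ?H. h x = ?s i}))"
    by (subst prod.reindex) (auto simp: inj_on_def)
  also have "\<dots> = (\<Prod>i\<le>d. fact (i - wsum G i))"
  proof (rule prod.cong[OF refl])
    fix i assume "i \<in> {..d}"
    then have "{x\<in>edges ?H. h x = ?s i} = Short i ` {..<i - wsum G i}"
      using no_short by (auto simp: edges_ext h_simps)
    then show "fact (card {x\<in>edges ?H. h x = ?s i}) = fact (i - wsum G i)"
      by (simp add: card_image inj_on_def)
  qed
  finally show ?thesis .
qed

definition ext_distribution :: "('e \<Rightarrow> nat) \<Rightarrow> 'e ext_edge \<Rightarrow> nat" where
  "ext_distribution \<Delta> x = (case x of Long e \<Rightarrow> \<Delta> e | Short i j \<Rightarrow> i)"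

lemma ext_distribution_simps [simp]:
  "ext_distribution \<Delta> (Long e) = \<Delta> e" "ext_distribution \<Delta> (Short i j) = i"
  by (simp_all add: ext_distribution_def)

text \<open>
  The new vertex on a short edge has no choice but the interval between its endpoints.
\<close>
lemma consistent_orderings_eq_placed:
  "consistent_orderings d G \<Delta> = placed_orderings (ext d G) (ext_distribution \<Delta>)"
proof -
  have short: "(Vtx i, Mid (Short i j)) \<in> r \<and> (Mid (Short i j), Vtx (i + 1)) \<in> r"
    if r: "r \<in> orderings (ext d G)" and x: "Short i j \<in> edges (ext d G)" for r i j
  proof -
    have "lft (ext d G) (Short i j) = i" "rgt (ext d G) (Short i j) = i + 1"
      by (simp_all add: ext_def)
    then show ?thesis
      using r x unfolding orderings_def by (metis (no_types, lifting) mem_Collect_eq)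
  qed
  have "(\<forall>e\<in>edges G. (Vtx (\<Delta> e), Mid (Long e)) \<in> r \<and> (Mid (Long e), Vtx (\<Delta> e + 1)) \<in> r) \<longleftrightarrow>
      (\<forall>x\<in>edges (ext d G). (Vtx (ext_distribution \<Delta> x), Mid x) \<in> r \<and>
        (Mid x, Vtx (ext_distribution \<Delta> x + 1)) \<in> r)" (is "?L \<longleftrightarrow> ?R")
    if r: "r \<in> orderings (ext d G)" for r
  proof
    assume L: ?L
    show ?R
    proof
      fix x assume x: "x \<in> edges (ext d G)"
      show "(Vtx (ext_distribution \<Delta> x), Mid x) \<in> r \<and> (Mid x, Vtx (ext_distribution \<Delta> x + 1)) \<in> r"
      proof (cases x)
        case (Long e)
        then have "e \<in> edges G"
          using x by (auto simp: edges_ext)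
        then show ?thesis
          using L Long by simp
      next
        case (Short i j)
        then show ?thesis
          using short[OF r] x by simp
      qed
    qed
  next
    assume R: ?R
    show ?L
    proof
      fix e assume "e \<in> edges G"
      then have "Long e \<in> edges (ext d G)"
        by (simp add: edges_ext)
      then show "(Vtx (\<Delta> e), Mid (Long e)) \<in> r \<and> (Mid (Long e), Vtx (\<Delta> e + 1)) \<in> r"
        using bspec[OF R] by fastforce
    qed
  qed
  then show ?thesis
    unfolding consistent_orderings_def placed_orderings_def by blast
qed

lemma card_consistent_orderings:
  assumes G: "long_edge_graph G" and d: "allowable d G" and \<Delta>: "distribution G \<Delta>"
  shows "finite (consistent_orderings d G \<Delta>)"
    and "card (consistent_orderings d G \<Delta>) =
      (\<Prod>i\<le>d. fact ((i - wsum G i) + card {e\<in>edges G. \<Delta> e = i}))"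
proof -
  let ?H = "ext d G" and ?\<delta> = "ext_distribution \<Delta>"
  have fin: "finite (edges G)"
    using G by (simp add: long_edge_graph_def)
  have lo: "lies_over ?H x (?\<delta> x)" if "x \<in> edges ?H" for x
    using that \<Delta> by (auto simp: edges_ext lies_over_def ext_def distribution_def)
  have "\<Delta> e \<le> d" if "e \<in> edges G" for e
    using rgt_le_if_allowable[OF G d that] \<Delta> that by (force simp: distribution_def lies_over_def)
  then have sub: "?\<delta> ` edges ?H \<subseteq> {..d}"
    by (auto simp: edges_ext)
  note placed = card_placed_orderings[OF finite_edges_ext[OF fin] lo finite_atMost sub]
  show "finite (consistent_orderings d G \<Delta>)"
    unfolding consistent_orderings_eq_placed by (rule placed)
  have "card {x\<in>edges ?H. ?\<delta> x = i} = (i - wsum G i) + card {e\<in>edges G. \<Delta> e = i}" if "i \<le> d" for i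
  proof -
    let ?S = "Short i ` {..<i - wsum G i} :: 'a ext_edge set" and ?L = "Long ` {e\<in>edges G. \<Delta> e = i}"
    have "{x\<in>edges ?H. ?\<delta> x = i} = ?S \<union> ?L"
      using that by (auto simp: edges_ext)
    moreover have "card (?S \<union> ?L) = card ?S + card ?L"
      by (rule card_Un_disjoint) (use fin in auto)
    ultimately show ?thesis
      by (simp add: card_image inj_on_def)
  qed
  then show "card (consistent_orderings d G \<Delta>) =
      (\<Prod>i\<le>d. fact ((i - wsum G i) + card {e\<in>edges G. \<Delta> e = i}))"
    using placed(2) by (simp add: consistent_orderings_eq_placed)
qed

lemma N_star_times_symmetries:
  assumes G: "long_edge_graph G" and d: "allowable d G" and \<Delta>: "distribution G \<Delta>"
  shows "(\<Prod>i\<le>d. fact (i - wsum G i)) * N_star d G \<Delta> = card (consistent_orderings d G \<Delta>)"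
proof -
  have fin: "finite (edges G)"
    using G by (simp add: long_edge_graph_def)
  let ?H = "ext d G"
  have X: "Long ` edges G \<subseteq> edges ?H"
    by (auto simp: edges_ext)
  have "card (edge_perms ?H (Long ` edges G)) * card (consistent_orderings d G \<Delta> //
      ordering_equiv ?H (range Vtx \<union> Mid ` Long ` edges G)) = card (consistent_orderings d G \<Delta>)"
  proof (rule card_ordering_classes[OF finite_edges_ext[OF fin] lft_less_rgt_ext[OF G] X
        card_consistent_orderings(1)[OF G d \<Delta>]])
    show "consistent_orderings d G \<Delta> \<subseteq> orderings ?H"
      by (auto simp: consistent_orderings_def)
    fix \<pi> r assume \<pi>: "\<pi> \<in> edge_perms ?H (Long ` edges G)" and r: "r \<in> consistent_orderings d G \<Delta>"
    have inj: "inj \<pi>"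
      using \<pi> permutes_inj by (auto simp: edge_perms_def)
    have "(Vtx (\<Delta> e), Mid (Long e)) \<in> relabel \<pi> r \<and> (Mid (Long e), Vtx (\<Delta> e + 1)) \<in> relabel \<pi> r"
      if "e \<in> edges G" for e
    proof -
      have "\<pi> (Long e) = Long e"
        using \<pi> that by (auto simp: edge_perms_def)
      then show ?thesis
        using relabel_mem_iff[OF inj, of "Vtx (\<Delta> e)" "Mid (Long e)" r]
          relabel_mem_iff[OF inj, of "Mid (Long e)" "Vtx (\<Delta> e + 1)" r] r that
        by (auto simp: consistent_orderings_def)
    qed
    moreover have "relabel \<pi> r \<in> orderings ?H"
      using relabel_orderings[OF \<pi>] r by (auto simp: consistent_orderings_def)
    ultimately show "relabel \<pi> r \<in> consistent_orderings d G \<Delta>"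
      by (simp add: consistent_orderings_def)
  qed
  then show ?thesis
    using d card_edge_perms_short[OF fin, of d] by (simp add: N_star_def)
qed

lemma N_star_eq_prod_pochhammer:
  assumes G: "long_edge_graph G" and d: "allowable d G" and \<Delta>: "distribution G \<Delta>"
  shows "real (N_star d G \<Delta>) =
    (\<Prod>i\<le>d. pochhammer (real (i - wsum G i) + 1) (card {e\<in>edges G. \<Delta> e = i}))"
proof -
  have "fact (m + n) = fact m * pochhammer (real m + 1) n" for m n :: nat
    using pochhammer_product[of m "m + n" "1 :: real"] by (simp add: pochhammer_fact add.commute)
  then have "(\<Prod>i\<le>d. fact (i - wsum G i)) * real (N_star d G \<Delta>) =
      (\<Prod>i\<le>d. fact (i - wsum G i)) *
      (\<Prod>i\<le>d. pochhammer (real (i - wsum G i) + 1) (card {e\<in>edges G. \<Delta> e = i}))"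
    using arg_cong[OF N_star_times_symmetries[OF G d \<Delta>], of real]
      card_consistent_orderings(2)[OF G d \<Delta>]
    by (simp add: prod.distrib)
  then show ?thesis
    by simp
qed

text \<open>
  Functions that are undefined outside the edge set, so that each distribution is counted once.
\<close>
definition distributions :: "'e multigraph \<Rightarrow> ('e \<Rightarrow> nat) set" where
  "distributions G = (\<Pi>\<^sub>E e\<in>edges G. {lft G e..<rgt G e})"

lemma distribution_if_in_distributions: "\<Delta> \<in> distributions G \<Longrightarrow> distribution G \<Delta>"
  by (force simp: distributions_def distribution_def lies_over_def)

text \<open>
  The right end of the interval is the first of the vertices 0, 1, 2, ... after the new vertex.
\<close>
lemma ordering_locates_edge:
  assumes r: "r \<in> orderings H" and e: "e \<in> edges H" "lft H e < rgt H e"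
  shows "\<exists>!i. i \<in> {lft H e..<rgt H e} \<and> (Vtx i, Mid e) \<in> r \<and> (Mid e, Vtx (i + 1)) \<in> r"
proof -
  have tr: "trans r" and as: "antisym r" and tot: "total_on (sub_verts H) r"
    and vtx: "\<And>i j. i \<le> j \<Longrightarrow> (Vtx i, Vtx j) \<in> r"
    and mid: "(Vtx (lft H e), Mid e) \<in> r" "(Mid e, Vtx (rgt H e)) \<in> r"
    using r e by (auto simp: orderings_def order_on_defs)
  have no: "\<not> (Mid e, Vtx i) \<in> r" if "(Vtx i, Mid e) \<in> r" for i
    using antisymD[OF as that] by auto
  have yes: "(Mid e, Vtx i) \<in> r" if "(Vtx i, Mid e) \<notin> r" for i
    using tot that e by (auto simp: total_on_def sub_verts_def)
  define j where "j = (LEAST j. (Mid e, Vtx j) \<in> r)"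
  have j: "(Mid e, Vtx j) \<in> r" and below: "\<And>i. i < j \<Longrightarrow> (Mid e, Vtx i) \<notin> r"
    unfolding j_def using mid(2) not_less_Least by (auto intro: LeastI)
  have "lft H e < j"
    using no[of j] transD[OF tr vtx mid(1)] j by (meson not_le)
  moreover have "j \<le> rgt H e"
    unfolding j_def by (rule Least_le) (rule mid)
  ultimately have "j - 1 \<in> {lft H e..<rgt H e} \<and> (Vtx (j - 1), Mid e) \<in> r \<and> (Mid e, Vtx (j - 1 + 1)) \<in> r"
    using below[of "j - 1"] yes[of "j - 1"] j by auto
  moreover have "i = i'" if "(Vtx i, Mid e) \<in> r" "(Mid e, Vtx (i + 1)) \<in> r"
      "(Vtx i', Mid e) \<in> r" "(Mid e, Vtx (i' + 1)) \<in> r" for i i'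
  proof -
    have "\<not> k < l" if "(Mid e, Vtx (k + 1)) \<in> r" "(Vtx l, Mid e) \<in> r" for k l
      using transD[OF tr that(1) vtx[of "k + 1" l]] no[OF that(2)] by auto
    then show ?thesis
      using that by (meson linorder_neqE_nat)
  qed
  ultimately show ?thesis
    by blast
qed

lemma orderings_eq_UN_consistent:
  assumes G: "long_edge_graph G"
  shows "orderings (ext d G) = (\<Union>\<Delta>\<in>distributions G. consistent_orderings d G \<Delta>)"
    and "\<Delta> \<in> distributions G \<Longrightarrow> \<Delta>' \<in> distributions G \<Longrightarrow> \<Delta> \<noteq> \<Delta>' \<Longrightarrow>
      consistent_orderings d G \<Delta> \<inter> consistent_orderings d G \<Delta>' = {}"
proof -
  let ?at = "\<lambda>r e i. i \<in> {lft G e..<rgt G e} \<and> (Vtx i, Mid (Long e)) \<in> r \<and>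
    (Mid (Long e), Vtx (i + 1)) \<in> r"
  have ex1: "\<exists>!i. ?at r e i" if "r \<in> orderings (ext d G)" "e \<in> edges G" for r e
  proof -
    have "Long e \<in> edges (ext d G)"
      using that by (simp add: edges_ext)
    from ordering_locates_edge[OF that(1) this lft_less_rgt_ext[OF G this]]
    show ?thesis
      by (simp add: ext_def)
  qed
  show "orderings (ext d G) = (\<Union>\<Delta>\<in>distributions G. consistent_orderings d G \<Delta>)"
  proof (intro equalityI subsetI)
    fix r assume r: "r \<in> orderings (ext d G)"
    define \<Delta> where "\<Delta> = restrict (\<lambda>e. THE i. ?at r e i) (edges G)"
    have at: "?at r e (\<Delta> e)" if "e \<in> edges G" for e
      using theI'[OF ex1[OF r that]] that by (simp add: \<Delta>_def)
    then have "\<Delta> \<in> distributions G"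
      unfolding distributions_def by (intro PiE_I) (auto simp: \<Delta>_def)
    moreover have "r \<in> consistent_orderings d G \<Delta>"
      using at r by (simp add: consistent_orderings_def)
    ultimately show "r \<in> (\<Union>\<Delta>\<in>distributions G. consistent_orderings d G \<Delta>)"
      by blast
  qed (auto simp: consistent_orderings_def)
  show "consistent_orderings d G \<Delta> \<inter> consistent_orderings d G \<Delta>' = {}"
    if D: "\<Delta> \<in> distributions G" "\<Delta>' \<in> distributions G" "\<Delta> \<noteq> \<Delta>'"
  proof (rule ccontr)
    assume "consistent_orderings d G \<Delta> \<inter> consistent_orderings d G \<Delta>' \<noteq> {}"
    then obtain r where r: "r \<in> consistent_orderings d G \<Delta>" "r \<in> consistent_orderings d G \<Delta>'"
      by auto
    have "\<Delta> e = \<Delta>' e" if e: "e \<in> edges G" for e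
    proof -
      have "?at r e (\<Delta> e)" "?at r e (\<Delta>' e)"
        using r e PiE_mem[OF D(1)[unfolded distributions_def] e]
          PiE_mem[OF D(2)[unfolded distributions_def] e]
        by (simp_all add: consistent_orderings_def)
      moreover have "r \<in> orderings (ext d G)"
        using r by (simp add: consistent_orderings_def)
      ultimately show ?thesis
        using ex1[OF _ e, of r] by blast
    qed
    then have "\<Delta> = \<Delta>'"
      using D(1,2) unfolding distributions_def by (intro PiE_ext)
    then show False
      using D(3) by simp
  qed
qed

lemma finite_distributions: "finite (edges G) \<Longrightarrow> finite (distributions G)"
  by (simp add: distributions_def finite_PiE)

text \<open>
  All orderings together, sorted by distribution, are counted by orbits of two groups: all
  automorphisms on the left, only those permuting short edges on the right. The ratio of the group
  orders is \<open>edge_symmetries G\<close>.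
\<close>
lemma symmetries_times_N:
  assumes G: "long_edge_graph G"
  shows "edge_symmetries G * N d G = multiplicity G * (\<Sum>\<Delta>\<in>distributions G. N_star d G \<Delta>)"
proof (cases "allowable d G")
  case d: True
  have fin: "finite (edges G)"
    using G by (simp add: long_edge_graph_def)
  let ?H = "ext d G"
  let ?s = "\<Prod>i\<le>d. fact (i - wsum G i) :: nat"
  have finR: "finite (orderings ?H)"
    unfolding orderings_eq_UN_consistent(1)[OF G]
    using finite_distributions[OF fin] card_consistent_orderings(1)[OF G d]
      distribution_if_in_distributions by blast
  have "card (edge_perms ?H {}) * card (orderings ?H // ordering_equiv ?H (range Vtx \<union> Mid ` {}))
      = card (orderings ?H)"
    by (rule card_ordering_classes[OF finite_edges_ext[OF fin] lft_less_rgt_ext[OF G]])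
      (use finR relabel_orderings in auto)
  then have "?s * (edge_symmetries G * card (orderings ?H // ordering_equiv ?H (range Vtx)))
      = card (orderings ?H)"
    unfolding card_edge_perms_ext[OF G] by (simp add: mult_ac)
  also have "\<dots> = (\<Sum>\<Delta>\<in>distributions G. card (consistent_orderings d G \<Delta>))"
    unfolding orderings_eq_UN_consistent(1)[OF G]
    using finite_distributions[OF fin] card_consistent_orderings(1)[OF G d]
      distribution_if_in_distributions orderings_eq_UN_consistent(2)[OF G]
    by (intro card_UN_disjoint) blast+
  also have "\<dots> = (\<Sum>\<Delta>\<in>distributions G. ?s * N_star d G \<Delta>)"
    by (intro sum.cong refl N_star_times_symmetries[OF G d, symmetric]
        distribution_if_in_distributions)
  also have "\<dots> = ?s * (\<Sum>\<Delta>\<in>distributions G. N_star d G \<Delta>)"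
    by (simp add: sum_distrib_left)
  finally have "edge_symmetries G * card (orderings ?H // ordering_equiv ?H (range Vtx))
      = (\<Sum>\<Delta>\<in>distributions G. N_star d G \<Delta>)"
    by simp
  then show ?thesis
    using d by (simp add: N_def mult.left_commute)
next
  case False
  then show ?thesis
    by (simp add: N_def N_star_def)
qed


section \<open>Linearity of Q* and Q\<close>

lemma N_star_cong:
  assumes "\<And>e. e \<in> edges G \<Longrightarrow> \<Delta> e = \<Delta>' e"
  shows "N_star d G \<Delta> = N_star d G \<Delta>'"
proof -
  have "consistent_orderings d G \<Delta> = consistent_orderings d G \<Delta>'"
    unfolding consistent_orderings_def using assms by auto
  then show ?thesis
    by (simp add: N_star_def)
qed

lemma edges_subgraph [simp]: "edges (subgraph G E) = E"
  and lft_subgraph [simp]: "lft (subgraph G E) = lft G"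
  and rgt_subgraph [simp]: "rgt (subgraph G E) = rgt G"
  and wgt_subgraph [simp]: "wgt (subgraph G E) = wgt G"
  by (simp_all add: subgraph_def)

lemma edges_translate [simp]: "edges (translate G k) = edges G"
  and lft_translate [simp]: "lft (translate G k) e = lft G e + k"
  and rgt_translate [simp]: "rgt (translate G k) e = rgt G e + k"
  and wgt_translate [simp]: "wgt (translate G k) = wgt G"
  by (simp_all add: translate_def)

lemma long_edge_graph_translate: "long_edge_graph G \<Longrightarrow> long_edge_graph (translate G k)"
  by (simp add: long_edge_graph_def short_edge_def len_def)

lemma distribution_translate:
  "distribution G \<Delta> \<Longrightarrow> distribution (translate G k) (translate_dist \<Delta> k)"
  by (simp add: distribution_def lies_over_def translate_dist_def)

lemma long_edge_graph_subgraph: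
  "long_edge_graph G \<Longrightarrow> E \<subseteq> edges G \<Longrightarrow> long_edge_graph (subgraph G E)"
  by (auto simp: long_edge_graph_def short_edge_def len_def intro: finite_subset)

lemma distribution_subgraph: "distribution G \<Delta> \<Longrightarrow> E \<subseteq> edges G \<Longrightarrow> distribution (subgraph G E) \<Delta>"
  by (auto simp: distribution_def lies_over_def)

lemma allowable_subgraph:
  assumes G: "long_edge_graph G" and d: "allowable d G" and E: "E \<subseteq> edges G"
  shows "allowable d (subgraph G E)"
proof -
  have fin: "finite (edges G)"
    using G by (simp add: long_edge_graph_def)
  have "degree (subgraph G E) v \<le> degree G v" for v
    unfolding degree_def by (rule card_mono) (use fin E in \<open>auto simp: incident_def\<close>)
  moreover have "wsum (subgraph G E) i \<le> wsum G i" for i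
    unfolding wsum_def wgt_subgraph by (rule sum_mono2) (use fin E in \<open>auto simp: lies_over_def\<close>)
  moreover have "degree G v = 0" if "v > d + 1" for v
    using d that by (simp add: allowable_def)
  moreover have "wsum G i \<le> i" for i
    using d by (simp add: allowable_def)
  moreover have "wgt G e = 1" if "e \<in> E" "incident (subgraph G E) e (d + 1)" for e
    using d E that by (auto simp: allowable_def incident_def)
  ultimately show ?thesis
    unfolding allowable_def by (metis edges_subgraph wgt_subgraph le_trans le_zero_eq)
qed

text \<open>
  The distributive law for factors indexed by disjoint blocks, where choosing a function on each
  block is choosing one function on the union.
\<close>
lemma prod_sum_PiE_Union:
  fixes \<phi> :: "'a set \<Rightarrow> ('a \<Rightarrow> 'b) \<Rightarrow> real"
  assumes "finite P" and "disjoint P"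
    and "\<And>E \<Delta> \<Delta>'. E \<in> P \<Longrightarrow> (\<And>e. e \<in> E \<Longrightarrow> \<Delta> e = \<Delta>' e) \<Longrightarrow> \<phi> E \<Delta> = \<phi> E \<Delta>'"
  shows "(\<Prod>E\<in>P. \<Sum>\<Delta>\<in>PiE E T. \<phi> E \<Delta>) = (\<Sum>\<Delta>\<in>PiE (\<Union>P) T. \<Prod>E\<in>P. \<phi> E \<Delta>)"
  using assms
proof (induction P rule: finite_induct)
  case empty
  then show ?case by simp
next
  case (insert E P)
  let ?U = "\<Union>P"
  have dis: "E \<inter> ?U = {}"
    using insert.prems(1) insert.hyps(2) by (auto simp: disjoint_def)
  have "disjoint P"
    using insert.prems(1) by (auto simp: disjoint_def)
  then have IH: "(\<Prod>E\<in>P. \<Sum>\<Delta>\<in>PiE E T. \<phi> E \<Delta>) = (\<Sum>\<Delta>\<in>PiE ?U T. \<Prod>E\<in>P. \<phi> E \<Delta>)"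
    by (rule insert.IH) (rule insert.prems(2), auto)
  have "(\<Prod>E\<in>insert E P. \<Sum>\<Delta>\<in>PiE E T. \<phi> E \<Delta>)
      = (\<Sum>\<Delta>\<in>PiE E T. \<phi> E \<Delta>) * (\<Sum>\<Delta>\<in>PiE ?U T. \<Prod>E\<in>P. \<phi> E \<Delta>)"
    using insert.hyps by (simp add: IH)
  also have "\<dots> = (\<Sum>(\<Delta>1, \<Delta>2)\<in>PiE E T \<times> PiE ?U T. \<phi> E \<Delta>1 * (\<Prod>E\<in>P. \<phi> E \<Delta>2))"
    by (simp add: sum_product sum.cartesian_product)
  also have "\<dots> = (\<Sum>\<Delta>\<in>PiE (E \<union> ?U) T. \<phi> E \<Delta> * (\<Prod>E\<in>P. \<phi> E \<Delta>))"
  proof (rule sum.reindex_bij_witness[of _ "\<lambda>\<Delta>. (restrict \<Delta> E, restrict \<Delta> ?U)"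
        "\<lambda>(\<Delta>1, \<Delta>2) e. if e \<in> E then \<Delta>1 e else \<Delta>2 e"])
    fix z assume "z \<in> PiE E T \<times> PiE ?U T"
    then obtain \<Delta>1 \<Delta>2 where z: "z = (\<Delta>1, \<Delta>2)" "\<Delta>1 \<in> PiE E T" "\<Delta>2 \<in> PiE ?U T"
      by auto
    let ?\<Delta> = "\<lambda>e. if e \<in> E then \<Delta>1 e else \<Delta>2 e"
    have "restrict ?\<Delta> E = \<Delta>1"
      using PiE_arb[OF z(2)] by (auto simp: fun_eq_iff restrict_def)
    moreover have "restrict ?\<Delta> ?U = \<Delta>2"
      using PiE_arb[OF z(3)] dis by (auto simp: fun_eq_iff restrict_def)
    ultimately show "(restrict (case z of (\<Delta>1, \<Delta>2) \<Rightarrow> \<lambda>e. if e \<in> E then \<Delta>1 e else \<Delta>2 e) E,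
        restrict (case z of (\<Delta>1, \<Delta>2) \<Rightarrow> \<lambda>e. if e \<in> E then \<Delta>1 e else \<Delta>2 e) ?U) = z"
      using z by simp
    show "(case z of (\<Delta>1, \<Delta>2) \<Rightarrow> \<lambda>e. if e \<in> E then \<Delta>1 e else \<Delta>2 e) \<in> PiE (E \<union> ?U) T"
      using z by (auto simp: PiE_def extensional_def Pi_def)
    have "\<phi> E ?\<Delta> = \<phi> E \<Delta>1"
      by (rule insert.prems(2)) auto
    moreover have "(\<Prod>B\<in>P. \<phi> B ?\<Delta>) = (\<Prod>B\<in>P. \<phi> B \<Delta>2)"
      by (rule prod.cong[OF refl], rule insert.prems(2)) (use dis in auto)
    ultimately show "\<phi> E (case z of (\<Delta>1, \<Delta>2) \<Rightarrow> \<lambda>e. if e \<in> E then \<Delta>1 e else \<Delta>2 e) *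
        (\<Prod>B\<in>P. \<phi> B (case z of (\<Delta>1, \<Delta>2) \<Rightarrow> \<lambda>e. if e \<in> E then \<Delta>1 e else \<Delta>2 e)) =
        (case z of (\<Delta>1, \<Delta>2) \<Rightarrow> \<phi> E \<Delta>1 * (\<Prod>E\<in>P. \<phi> E \<Delta>2))"
      using z by simp
  next
    fix \<Delta> assume \<Delta>: "\<Delta> \<in> PiE (E \<union> ?U) T"
    show "(case (restrict \<Delta> E, restrict \<Delta> ?U) of (\<Delta>1, \<Delta>2) \<Rightarrow>
        \<lambda>e. if e \<in> E then \<Delta>1 e else \<Delta>2 e) = \<Delta>"
      using PiE_arb[OF \<Delta>] by (auto simp: fun_eq_iff restrict_def)
    show "(restrict \<Delta> E, restrict \<Delta> ?U) \<in> PiE E T \<times> PiE ?U T"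
      using \<Delta> by (auto simp: PiE_def Pi_def)
  qed
  also have "\<dots> = (\<Sum>\<Delta>\<in>PiE (\<Union>(insert E P)) T. \<Prod>E\<in>insert E P. \<phi> E \<Delta>)"
    using insert.hyps by simp
  finally show ?case .
qed

text \<open>
  In each product over the blocks of a partition, the multiplicities combine to that of
  \<open>G\<close>, and the distributions of the blocks combine to one distribution of
  \<open>G\<close>.
\<close>
lemma Q_eq_sum_Q_star:
  assumes G: "long_edge_graph G"
  shows "Q d G = real (multiplicity G) / real (edge_symmetries G) *
    (\<Sum>\<Delta>\<in>distributions G. Q_star d G \<Delta>)"
proof (cases "edges G = {}")
  case True
  then show ?thesis
    by (simp add: Q_def Q_star_def)
next
  case False
  have fin: "finite (edges G)"
    using G by (simp add: long_edge_graph_def)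
  let ?T = "\<lambda>e. {lft G e..<rgt G e}"
  let ?c = "\<lambda>P :: 'a set set. (- 1) ^ (card P - 1) * fact (card P - 1) :: real"
  let ?N = "\<lambda>E \<Delta>. real (N_star d (subgraph G E) \<Delta>)"
  have block: "(\<Prod>E\<in>P. real (edge_symmetries (subgraph G E)) * real (N d (subgraph G E))) =
      real (multiplicity G) * (\<Sum>\<Delta>\<in>distributions G. \<Prod>E\<in>P. ?N E \<Delta>)"
    if P: "partition_on (edges G) P" for P
  proof -
    have UP: "\<Union>P = edges G" and dis: "disjoint P"
      using P by (auto simp: partition_on_def)
    have finP: "finite P"
      using finite_elements[OF fin P] .
    have sub: "E \<subseteq> edges G" if "E \<in> P" for E
      using UP that by auto
    have "real (edge_symmetries (subgraph G E)) * real (N d (subgraph G E)) =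
        real (multiplicity (subgraph G E)) * (\<Sum>\<Delta>\<in>PiE E ?T. ?N E \<Delta>)" if "E \<in> P" for E
      using arg_cong[OF symmetries_times_N[OF long_edge_graph_subgraph[OF G sub[OF that]], of d],
          of real]
      by (simp add: distributions_def)
    then have "(\<Prod>E\<in>P. real (edge_symmetries (subgraph G E)) * real (N d (subgraph G E))) =
        (\<Prod>E\<in>P. real (multiplicity (subgraph G E))) * (\<Prod>E\<in>P. \<Sum>\<Delta>\<in>PiE E ?T. ?N E \<Delta>)"
      by (simp add: prod.distrib)
    also have "(\<Prod>E\<in>P. real (multiplicity (subgraph G E))) = real (multiplicity G)"
    proof -
      have "(\<Prod>e\<in>\<Union>P. (wgt G e)\<^sup>2) = (\<Prod>E\<in>P. \<Prod>e\<in>E. (wgt G e)\<^sup>2)"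
        using dis finite_subset[OF sub fin] by (subst prod.Union_disjoint) (auto simp: disjoint_def)
      then show ?thesis
        by (simp add: multiplicity_def UP)
    qed
    also have "(\<Prod>E\<in>P. \<Sum>\<Delta>\<in>PiE E ?T. ?N E \<Delta>) = (\<Sum>\<Delta>\<in>PiE (\<Union>P) ?T. \<Prod>E\<in>P. ?N E \<Delta>)"
      using finP dis by (rule prod_sum_PiE_Union) (auto intro: N_star_cong)
    finally show ?thesis
      by (simp add: UP distributions_def)
  qed
  have "(\<Sum>P | partition_on (edges G) P. ?c P *
      (\<Prod>E\<in>P. real (edge_symmetries (subgraph G E)) * real (N d (subgraph G E)))) =
      (\<Sum>P | partition_on (edges G) P. \<Sum>\<Delta>\<in>distributions G.
        real (multiplicity G) * (?c P * (\<Prod>E\<in>P. ?N E \<Delta>)))"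
    by (rule sum.cong) (simp_all add: block sum_distrib_left mult_ac)
  also have "\<dots> = real (multiplicity G) * (\<Sum>\<Delta>\<in>distributions G. Q_star d G \<Delta>)"
    using False by (subst sum.swap) (simp add: Q_star_def sum_distrib_left)
  finally show ?thesis
    using False by (simp add: Q_def)
qed

text \<open>
  The upper bound \<open>d\<close> on the intervals disappears, as an interval without new
  vertices of edges of \<open>E\<close> contributes a factor 1. Allowability makes the truncated
  subtraction exact.
\<close>
lemma N_star_translate_eq_slot_product:
  assumes G: "long_edge_graph G" and \<Delta>: "distribution G \<Delta>"
    and d: "allowable d (translate G k)" and E: "E \<subseteq> edges G"
  defines "w \<equiv> \<lambda>e i. if lies_over G e i then int (wgt G e) else 0"
  shows "real (N_star d (subgraph (translate G k) E) (translate_dist \<Delta> k)) =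
    slot_product (\<Delta> ` edges G) \<Delta> w (\<lambda>i. int i + int k) E"
proof -
  let ?G = "subgraph (translate G k) E" and ?D = "translate_dist \<Delta> k"
  let ?I = "\<Delta> ` edges G"
  have fin: "finite (edges G)"
    using G by (simp add: long_edge_graph_def)
  note G' = long_edge_graph_translate[OF G, of k]
  have allow: "allowable d ?G"
    using allowable_subgraph[OF G' d] E by simp
  have w: "wsum ?G (i + k) = (\<Sum>e\<in>E. w e i)" for i
  proof -
    have "wsum ?G (i + k) = (\<Sum>e\<in>{e\<in>E. lies_over G e i}. wgt G e)"
      by (simp add: wsum_def lies_over_def)
    then show ?thesis
      using finite_subset[OF E fin] by (simp add: w_def sum.inter_filter if_distrib cong: if_cong)
  qed
  have sub: "(\<lambda>i. i + k) ` ?I \<subseteq> {..d}"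
    using rgt_le_if_allowable[OF G' d] \<Delta>
    by (force simp: distribution_def lies_over_def)
  have "real (N_star d ?G ?D) =
      (\<Prod>i\<le>d. pochhammer (real (i - wsum ?G i) + 1) (card {e\<in>E. \<Delta> e + k = i}))"
    using N_star_eq_prod_pochhammer[OF long_edge_graph_subgraph[OF G'] allow
        distribution_subgraph[OF distribution_translate[OF \<Delta>]]] E
    by (simp add: translate_dist_def)
  also have "\<dots> = (\<Prod>i\<in>(\<lambda>i. i + k) ` ?I.
      pochhammer (real (i - wsum ?G i) + 1) (card {e\<in>E. \<Delta> e + k = i}))"
  proof (rule prod.mono_neutral_right[OF finite_atMost sub], rule ballI)
    fix i assume "i \<in> {..d} - (\<lambda>i. i + k) ` ?I"
    then have none: "{e\<in>E. \<Delta> e + k = i} = {}"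
      using E by auto
    show "pochhammer (real (i - wsum ?G i) + 1) (card {e\<in>E. \<Delta> e + k = i}) = 1"
      unfolding none by simp
  qed
  also have "\<dots> = (\<Prod>i\<in>?I. pochhammer (real (i + k - wsum ?G (i + k)) + 1) (card {e\<in>E. \<Delta> e = i}))"
    by (subst prod.reindex) (auto simp: inj_on_def)
  also have "\<dots> = slot_product ?I \<Delta> w (\<lambda>i. int i + int k) E"
    unfolding slot_product_def
  proof (rule prod.cong[OF refl])
    fix i
    have "wsum ?G (i + k) \<le> i + k"
      using allow by (simp add: allowable_def)
    then have "int (i + k - wsum ?G (i + k)) = int i + int k - (\<Sum>e\<in>E. w e i)"
      by (simp add: of_nat_diff w)
    then have "real (i + k - wsum ?G (i + k)) = real_of_int (int i + int k - (\<Sum>e\<in>E. w e i))"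
      by (metis of_int_of_nat_eq)
    then show "pochhammer (real (i + k - wsum ?G (i + k)) + 1) (card {e\<in>E. \<Delta> e = i}) =
        pochhammer (real_of_int (int i + int k - (\<Sum>e\<in>E. w e i)) + 1) (card {e\<in>E. \<Delta> e = i})"
      by simp
  qed
  finally show ?thesis .
qed

lemma Q_star_translate_affine:
  assumes G: "long_edge_graph G" and \<Delta>: "distribution G \<Delta>"
  shows "\<exists>a b. \<forall>k d. allowable d (translate G k) \<longrightarrow>
    Q_star d (translate G k) (translate_dist \<Delta> k) = a * real k + b"
proof (cases "edges G = {}")
  case True
  then show ?thesis
    by (intro exI[of _ 0]) (simp add: Q_star_def)
next
  case False
  have fin: "finite (edges G)"
    using G by (simp add: long_edge_graph_def)
  define F where "F = slot_product (\<Delta> ` edges G) \<Delta> (\<lambda>e i. if lies_over G e i then int (wgt G e) else 0)"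
  let ?c = "\<lambda>x. cumulant (F x) (edges G)"
  have "Q_star d (translate G k) (translate_dist \<Delta> k) =
      (?c (\<lambda>i. int i + 1) - ?c int) * real k + ?c int" if d: "allowable d (translate G k)" for k d
  proof -
    have "Q_star d (translate G k) (translate_dist \<Delta> k) =
        cumulant (\<lambda>E. real (N_star d (subgraph (translate G k) E) (translate_dist \<Delta> k))) (edges G)"
      using False by (simp add: Q_star_def cumulant_def)
    also have "\<dots> = ?c (\<lambda>i. int i + int k)"
      unfolding F_def by (rule cumulant_cong) (rule N_star_translate_eq_slot_product[OF G \<Delta> d])
    also have "\<dots> = (?c (\<lambda>i. int i + 1) - ?c int) * real k + ?c int"
      unfolding F_def by (rule cumulant_slot_product_shift) (use fin False in auto)
    finally show ?thesis .
  qed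
  then show ?thesis
    by blast
qed

lemma Q_star_cong:
  assumes "\<And>e. e \<in> edges G \<Longrightarrow> \<Delta> e = \<Delta>' e"
  shows "Q_star d G \<Delta> = Q_star d G \<Delta>'"
proof -
  have "N_star d (subgraph G E) \<Delta> = N_star d (subgraph G E) \<Delta>'"
    if "E \<in> P" "partition_on (edges G) P" for E P
    by (rule N_star_cong) (use that assms in \<open>auto simp: partition_on_def\<close>)
  then show ?thesis
    by (simp add: Q_star_def)
qed

lemma Q_translate_eq_sum:
  assumes G: "long_edge_graph G"
  shows "Q d (translate G k) = real (multiplicity G) / real (edge_symmetries G) *
    (\<Sum>\<Delta>\<in>distributions G. Q_star d (translate G k) (translate_dist \<Delta> k))"
proof -
  let ?G = "translate G k"
  have "multiplicity ?G = multiplicity G" "edge_symmetries ?G = edge_symmetries G"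
    by (simp_all add: multiplicity_def edge_symmetries_def)
  moreover have "(\<Sum>\<Delta>\<in>distributions ?G. Q_star d ?G \<Delta>) =
      (\<Sum>\<Delta>\<in>distributions G. Q_star d ?G (translate_dist \<Delta> k))"
  proof (rule sum.reindex_bij_witness[of _ "\<lambda>\<Delta>. restrict (translate_dist \<Delta> k) (edges G)"
        "\<lambda>\<Delta>. restrict (\<lambda>e. \<Delta> e - k) (edges G)"])
    fix \<Delta> assume "\<Delta> \<in> distributions ?G"
    then have mem: "\<And>e. e \<in> edges G \<Longrightarrow> \<Delta> e \<in> {lft G e + k..<rgt G e + k}"
      and arb: "\<And>e. e \<notin> edges G \<Longrightarrow> \<Delta> e = undefined"
      by (auto simp: distributions_def PiE_def Pi_def extensional_def)
    show "restrict (translate_dist (restrict (\<lambda>e. \<Delta> e - k) (edges G)) k) (edges G) = \<Delta>"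
      using mem arb by (force simp: fun_eq_iff restrict_def translate_dist_def)
    show "restrict (\<lambda>e. \<Delta> e - k) (edges G) \<in> distributions G"
      using mem by (force simp: distributions_def)
    show "Q_star d ?G (translate_dist (restrict (\<lambda>e. \<Delta> e - k) (edges G)) k) = Q_star d ?G \<Delta>"
      by (rule Q_star_cong) (use mem in \<open>force simp: translate_dist_def\<close>)
  next
    fix \<Delta> assume "\<Delta> \<in> distributions G"
    then have mem: "\<And>e. e \<in> edges G \<Longrightarrow> \<Delta> e \<in> {lft G e..<rgt G e}"
      and arb: "\<And>e. e \<notin> edges G \<Longrightarrow> \<Delta> e = undefined"
      by (auto simp: distributions_def PiE_def Pi_def extensional_def)
    show "restrict (\<lambda>e. restrict (translate_dist \<Delta> k) (edges G) e - k) (edges G) = \<Delta>"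
      using arb by (auto simp: fun_eq_iff restrict_def translate_dist_def)
    show "restrict (translate_dist \<Delta> k) (edges G) \<in> distributions ?G"
      using mem by (force simp: distributions_def translate_dist_def)
  qed
  ultimately show ?thesis
    using Q_eq_sum_Q_star[OF long_edge_graph_translate[OF G], of d k] by simp
qed

theorem theorem3p7:
  fixes G :: "'e multigraph" and \<Delta> :: "'e \<Rightarrow> nat"
  assumes "long_edge_graph G" and "distribution G \<Delta>"
  shows "(\<exists>(a::real) (b::real) (K::nat). \<forall>k\<ge>K. \<forall>d::nat. d \<ge> 1 \<longrightarrow> allowable d (translate G k) \<longrightarrow>
            Q_star d (translate G k) (translate_dist \<Delta> k) = a * real k + b) \<and>
         (\<exists>(a'::real) (b'::real) (K'::nat). \<forall>k\<ge>K'. \<forall>d::nat. d \<ge> 1 \<longrightarrow> allowable d (translate G k) \<longrightarrow>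
            Q d (translate G k) = a' * real k + b')"
proof
  show "\<exists>(a::real) (b::real) (K::nat). \<forall>k\<ge>K. \<forall>d::nat. d \<ge> 1 \<longrightarrow> allowable d (translate G k) \<longrightarrow>
      Q_star d (translate G k) (translate_dist \<Delta> k) = a * real k + b"
    using Q_star_translate_affine[OF assms] by blast
  have "\<forall>\<Delta>\<in>distributions G. \<exists>a b. \<forall>k d. allowable d (translate G k) \<longrightarrow>
      Q_star d (translate G k) (translate_dist \<Delta> k) = a * real k + b"
    using Q_star_translate_affine[OF assms(1)] distribution_if_in_distributions by blast
  then obtain a b where ab: "\<And>\<Delta> k d. \<Delta> \<in> distributions G \<Longrightarrow> allowable d (translate G k) \<Longrightarrow>
      Q_star d (translate G k) (translate_dist \<Delta> k) = a \<Delta> * real k + b \<Delta>"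
    by metis
  let ?m = "real (multiplicity G) / real (edge_symmetries G)"
  have "Q d (translate G k) = (?m * sum a (distributions G)) * real k + ?m * sum b (distributions G)"
    if "allowable d (translate G k)" for d k
    unfolding Q_translate_eq_sum[OF assms(1)]
    by (simp add: ab that sum.distrib sum_distrib_right[symmetric] distrib_left)
  then show "\<exists>(a'::real) (b'::real) (K'::nat). \<forall>k\<ge>K'. \<forall>d::nat. d \<ge> 1 \<longrightarrow>
      allowable d (translate G k) \<longrightarrow> Q d (translate G k) = a' * real k + b'"
    by blast
qed

end
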